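(* Let $n\ge1$, $p,q>1$, let $\Theta\subset\mathbb{R}^{n+1}$ be open and bounded, and let $\xi_0=(x_0,t_0)\in\partial\Theta$. Let $\Theta_-=\{(x,t)\in\Theta:\ t<t_0\}$. If $\xi_0\notin\partial\Theta_-$, then $\xi_0$ is regular with respect to $\Theta$ for the equation $\partial_t u=\Delta_p^q u$. In particular, this holds if $\Theta_-=\emptyset$.
   Context: Equation. Points of $\mathbb{R}^{n+1}$ are written $(x,t)$, and $\nabla$, $\Delta$, $D^2$ act in $x$ only. The equation is (E): $\partial_t u=\Delta_p^q u$, where for $\nabla u\neq 0$, $\Delta_p^q u=|\nabla u|^{q-p}\operatorname{div}(|\nabla u|^{p-2}\nabla u)=F(\nabla u,D^2u)$ with $F(\eta,X)=|\eta|^{q-2}\operatorname{Tr}\big(X+(p-2)\tfrac{\eta\otimes\eta}{|\eta|^2}X\big)$ for $\eta\in\mathbb{R}^n\setminus\{0\}$ and $X$ a symmetric $n\times n$ matrix. Admissible functions. $\mathcal{F}(F)$ is the set of $f\in C^2([0,\infty))$ with $f(0)=f'(0)=f''(0)=0$, $f''(r)>0$ for all $r>0$, and $\lim_{x\to 0,\,x\ne 0}F(\nabla g(x),D^2g(x))=0$ for $g(x)=f(|x|)$. $\Sigma$ is the set of even $\sigma\in C^1(\mathbb{R})$ with $\sigma(0)=\sigma'(0)=0$ and $\sigma(r)>0$ for $r>0$. A function $\varphi\in C^2(\Theta)$ is admissible at $(x_0,t_0)\in\Theta$ if either $\nabla\varphi(x_0,t_0)\ne0$, or there are $\delta>0$,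 $f\in\mathcal{F}(F)$, $\sigma\in\Sigma$ such that $|\varphi(x,t)-\varphi(x_0,t_0)-\partial_t\varphi(x_0,t_0)(t-t_0)|\le f(|x-x_0|)+\sigma(t-t_0)$ for all $(x,t)\in B_\delta(x_0)\times(t_0-\delta,t_0+\delta)$. Viscosity supersolutions. $u:\Theta\to\mathbb{R}\cup\{\infty\}$ is a viscosity supersolution of (E) in $\Theta$ if (1) $u$ is lower semicontinuous; (2) $u$ is finite in a dense subset of $\Theta$; (3) whenever $\varphi\in C^2(\Theta)$ is admissible at $\xi\in\Theta$ and touches $u$ at $\xi$ from below (i.e. $\varphi(\xi)=u(\xi)$ and $\varphi<u$ in a punctured neighborhood of $\xi$), then $\partial_t\varphi(\xi)-\Delta_p^q\varphi(\xi)\ge0$ if $\nabla\varphi(\xi)\ne0$, and $\partial_t\varphi(\xi)\ge0$ if $\nabla\varphi(\xi)=0$. Perron solutions and regularity. For bounded $f:\partial\Theta\to\mathbb{R}$, $\mathcal{U}_f$ is the class of viscosity supersolutions $u$ of (E) in $\Theta$ that are bounded from below and satisfy $\liminf_{\Theta\ni\eta\to\xi}u(\eta)\ge f(\xi)$ for all $\xi\in\partial\Theta$; the upper Perron solution is $\overline{H}f(\xi)=\inf_{u\in\mathcal{U}_f}u(\xi)$, $\xi\in\Theta$. A point $\xi_0\in\partial\Theta$ is regular (with respect to $\Theta$) if $\lim_{\Theta\ni\xi\to\xi_0}\overline{H}f(\xi)=f(\xi_0)$ for every $f\in C(\partial\Theta)$. *)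

theory Defs
  imports "HOL-Analysis.Analysis"
begin

definition grad :: "(real ^ 'n \<Rightarrow> real) \<Rightarrow> real ^ 'n \<Rightarrow> real ^ 'n" where
  "grad u x = (\<chi> i. frechet_derivative u (at x) (axis i 1))"

definition hess :: "(real ^ 'n \<Rightarrow> real) \<Rightarrow> real ^ 'n \<Rightarrow> real ^ 'n ^ 'n" where
  "hess u x = jacobian (grad u) (at x)"

definition divergence :: "(real ^ 'n \<Rightarrow> real ^ 'n) \<Rightarrow> real ^ 'n \<Rightarrow> real" where
  "divergence V x = trace (jacobian V (at x))"

definition outer_prod :: "real ^ 'n \<Rightarrow> real ^ 'n \<Rightarrow> real ^ 'n ^ 'n" where
  "outer_prod a b = (\<chi> i j. a $ i * b $ j)"

definition pq_laplacian :: "real \<Rightarrow> real \<Rightarrow> (real ^ 'n \<Rightarrow> real) \<Rightarrow> real ^ 'n \<Rightarrow> real" where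
  "pq_laplacian p q u x =
     norm (grad u x) powr (q - p) *
     divergence (\<lambda>y. norm (grad u y) powr (p - 2) *\<^sub>R grad u y) x"

definition pq_op :: "real \<Rightarrow> real \<Rightarrow> real ^ 'n \<Rightarrow> real ^ 'n ^ 'n \<Rightarrow> real" where
  "pq_op p q \<eta> X =
     norm \<eta> powr (q - 2) *
     trace (X + (p - 2) *\<^sub>R ((outer_prod \<eta> \<eta> /\<^sub>R (norm \<eta>)\<^sup>2) ** X))"

text \<open>The divergence form and the non-divergence form agree where the gradient does not vanish.\<close>

lemma pq_laplacian_eq_pq_op:
  fixes u :: "real ^ 'n \<Rightarrow> real"
  assumes "grad u differentiable (at x)" and nz: "grad u x \<noteq> 0"
  shows "pq_laplacian p q u x = pq_op p q (grad u x) (hess u x)"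
proof -
  define G where "G = grad u x"
  define A where "A = frechet_derivative (grad u) (at x)"
  have G0: "norm G > 0" using nz by (simp add: G_def)
  have dA: "(grad u has_derivative A) (at x)"
    using assms(1) unfolding A_def frechet_derivative_works .
  let ?V = "\<lambda>y. norm (grad u y) powr (p - 2) *\<^sub>R grad u y"
  let ?V' = "\<lambda>h. norm G powr (p - 2) *\<^sub>R A h
     + ((p - 2) * norm G powr (p - 4) * (G \<bullet> A h)) *\<^sub>R G"
  have dn: "((\<lambda>y. norm (grad u y)) has_derivative (\<lambda>h. A h \<bullet> sgn G)) (at x)"
    using has_derivative_compose[OF dA has_derivative_norm[OF nz]] by (simp add: G_def)
  have dp: "((\<lambda>y. norm (grad u y) powr (p - 2)) has_derivative
      (\<lambda>h. (A h \<bullet> sgn G) * ((p - 2) * norm G powr (p - 2 - 1)))) (at x)"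
  proof -
    have "((\<lambda>r. r powr (p - 2)) has_real_derivative (p - 2) * norm G powr (p - 2 - 1)) (at (norm G))"
      using G0 by (rule has_real_derivative_powr)
    from DERIV_compose_FDERIV[OF this[unfolded G_def] dn] show ?thesis
      by (simp add: G_def)
  qed
  have e: "(A h \<bullet> sgn G) * ((p - 2) * norm G powr (p - 2 - 1))
      = (p - 2) * norm G powr (p - 4) * (G \<bullet> A h)" for h
  proof -
    have "norm G powr (p - 2 - 1) = norm G powr (p - 4) * norm G"
      using G0 powr_add[of "norm G" "p - 4" 1] by (simp add: powr_one)
    then show ?thesis
      using G0 by (simp add: sgn_div_norm inner_commute field_simps)
  qed
  have dV: "(?V has_derivative ?V') (at x)"
    using has_derivative_scaleR[OF dp[unfolded e] dA] by (simp add: G_def)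
  have J: "jacobian ?V (at x) = matrix ?V'"
    unfolding jacobian_def using frechet_derivative_at[OF dV] by simp
  have X: "hess u x = matrix A" by (simp add: hess_def jacobian_def A_def)
  define S where "S = (\<Sum>i\<in>UNIV. \<Sum>j\<in>UNIV. G $ i * G $ j * A (axis i 1) $ j)"
  have t1: "trace (matrix (\<lambda>h. a *\<^sub>R A h + (c * (G \<bullet> A h)) *\<^sub>R G)) = a * trace (matrix A) + c * S"
    for a c
    by (simp add: S_def trace_def matrix_def inner_vec_def sum.distrib sum_distrib_left mult_ac)
  have t2: "trace (matrix A + c *\<^sub>R ((outer_prod G G /\<^sub>R (norm G)\<^sup>2) ** matrix A))
     = trace (matrix A) + c / (norm G)\<^sup>2 * S" for c
    by (simp add: S_def trace_def matrix_def matrix_matrix_mult_def outer_prod_def sum.distrib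
        sum_distrib_left divide_inverse mult_ac)
  have p2: "norm G powr (q - p) * norm G powr (p - 2) = norm G powr (q - 2)"
    by (simp flip: powr_add)
  have p4: "norm G powr (q - p) * norm G powr (p - 4) = norm G powr (q - 2) / (norm G)\<^sup>2"
  proof -
    have "norm G powr (q - 2) = norm G powr (q - 4) * norm G powr 2"
      by (subst powr_add[symmetric]) simp
    then show ?thesis using G0 by (simp add: powr_numeral flip: powr_add)
  qed
  have "pq_laplacian p q u x = norm G powr (q - p) * trace (matrix ?V')"
    by (simp add: pq_laplacian_def divergence_def J G_def)
  also have "\<dots> = (norm G powr (q - p) * norm G powr (p - 2)) * trace (matrix A)
     + (p - 2) * (norm G powr (q - p) * norm G powr (p - 4)) * S"
    unfolding t1 by (simp only: algebra_simps)
  also have "\<dots> = pq_op p q G (matrix A)"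
    unfolding pq_op_def t2 p2 p4 by (simp add: algebra_simps)
  finally show ?thesis by (simp add: X G_def)
qed

definition time_deriv :: "((real ^ 'n) \<times> real \<Rightarrow> real) \<Rightarrow> (real ^ 'n) \<times> real \<Rightarrow> real" where
  "time_deriv \<phi> = (\<lambda>(x, t). deriv (\<lambda>s. \<phi> (x, s)) t)"

definition space_grad :: "((real ^ 'n) \<times> real \<Rightarrow> real) \<Rightarrow> (real ^ 'n) \<times> real \<Rightarrow> real ^ 'n" where
  "space_grad \<phi> = (\<lambda>(x, t). grad (\<lambda>y. \<phi> (y, t)) x)"

definition space_pq_laplacian ::
    "real \<Rightarrow> real \<Rightarrow> ((real ^ 'n) \<times> real \<Rightarrow> real) \<Rightarrow> (real ^ 'n) \<times> real \<Rightarrow> real" where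
  "space_pq_laplacian p q \<phi> = (\<lambda>(x, t). pq_laplacian p q (\<lambda>y. \<phi> (y, t)) x)"

text \<open>\<open>C\<^sup>2\<close> on an open set, with Frechet derivatives in the operator norm.\<close>

definition C2_on :: "'a::real_normed_vector set \<Rightarrow> ('a \<Rightarrow> real) \<Rightarrow> bool" where
  "C2_on S \<phi> \<longleftrightarrow>
     (\<exists>(\<phi>' :: 'a \<Rightarrow> 'a \<Rightarrow>\<^sub>L real) (\<phi>'' :: 'a \<Rightarrow> 'a \<Rightarrow>\<^sub>L ('a \<Rightarrow>\<^sub>L real)).
        (\<forall>z\<in>S. (\<phi> has_derivative blinfun_apply (\<phi>' z)) (at z)) \<and>
        (\<forall>z\<in>S. (\<phi>' has_derivative blinfun_apply (\<phi>'' z)) (at z)) \<and>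
        continuous_on S \<phi>'')"

text \<open>
  The class \<open>\<F>(F)\<close>. Its members live on the half-line, so derivatives at 0 are one-sided and
  values at negative arguments are irrelevant. The last condition depends on the dimension, hence
  the type argument.
\<close>

definition F_class :: "'n::finite itself \<Rightarrow> real \<Rightarrow> real \<Rightarrow> (real \<Rightarrow> real) set" where
  "F_class _ p q = {f.
     (\<exists>f' f''.
        (\<forall>r\<ge>0. (f has_real_derivative f' r) (at r within {0..})) \<and>
        (\<forall>r\<ge>0. (f' has_real_derivative f'' r) (at r within {0..})) \<and>
        continuous_on {0..} f'' \<and>
        f 0 = 0 \<and> f' 0 = 0 \<and> f'' 0 = 0 \<and> (\<forall>r>0. f'' r > 0)) \<and>
     ((\<lambda>x :: real ^ 'n. pq_op p q (grad (\<lambda>y. f (norm y)) x) (hess (\<lambda>y. f (norm y)) x))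
        \<longlongrightarrow> 0) (at 0)}"

definition Sigma_class :: "(real \<Rightarrow> real) set" where
  "Sigma_class = {\<sigma>. \<sigma> C1_differentiable_on UNIV \<and> (\<forall>r. \<sigma> (- r) = \<sigma> r) \<and>
     \<sigma> 0 = 0 \<and> deriv \<sigma> 0 = 0 \<and> (\<forall>r>0. \<sigma> r > 0)}"

definition admissible_at ::
    "real \<Rightarrow> real \<Rightarrow> ((real ^ 'n) \<times> real \<Rightarrow> real) \<Rightarrow> (real ^ 'n) \<times> real \<Rightarrow> bool" where
  "admissible_at p q \<phi> = (\<lambda>(x\<^sub>0, t\<^sub>0).
     space_grad \<phi> (x\<^sub>0, t\<^sub>0) \<noteq> 0 \<or>
     (\<exists>\<delta>>0. \<exists>f\<in>F_class TYPE('n) p q. \<exists>\<sigma>\<in>Sigma_class.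
        \<forall>x\<in>ball x\<^sub>0 \<delta>. \<forall>t\<in>{t\<^sub>0 - \<delta><..<t\<^sub>0 + \<delta>}.
          \<bar>\<phi> (x, t) - \<phi> (x\<^sub>0, t\<^sub>0) - time_deriv \<phi> (x\<^sub>0, t\<^sub>0) * (t - t\<^sub>0)\<bar>
            \<le> f (norm (x - x\<^sub>0)) + \<sigma> (t - t\<^sub>0)))"

definition touches_from_below ::
    "'a::topological_space set \<Rightarrow> ('a \<Rightarrow> real) \<Rightarrow> ('a \<Rightarrow> ereal) \<Rightarrow> 'a \<Rightarrow> bool" where
  "touches_from_below \<Theta> \<phi> u \<xi> \<longleftrightarrow>
     ereal (\<phi> \<xi>) = u \<xi> \<and> (\<forall>\<^sub>F \<eta> in at \<xi> within \<Theta>. ereal (\<phi> \<eta>) < u \<eta>)"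

text \<open>
  Functions on \<open>\<Theta>\<close> with values in the reals or \<open>\<infinity>\<close> are total functions into \<^typ>\<open>ereal\<close>, constrained
  only on \<open>\<Theta>\<close>, where the value \<open>-\<infinity>\<close> is excluded.
\<close>

definition viscosity_supersolution ::
    "real \<Rightarrow> real \<Rightarrow> ((real ^ 'n) \<times> real) set \<Rightarrow> ((real ^ 'n) \<times> real \<Rightarrow> ereal) \<Rightarrow> bool" where
  "viscosity_supersolution p q \<Theta> u \<longleftrightarrow>
     (\<forall>\<xi>\<in>\<Theta>. u \<xi> \<noteq> -\<infinity>) \<and>
     (\<forall>\<xi>\<in>\<Theta>. u \<xi> \<le> Liminf (at \<xi> within \<Theta>) u) \<and>
     \<Theta> \<subseteq> closure {\<xi>\<in>\<Theta>. u \<xi> \<noteq> \<infinity>} \<and>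
     (\<forall>\<phi>. \<forall>\<xi>\<in>\<Theta>.
        C2_on \<Theta> \<phi> \<and> admissible_at p q \<phi> \<xi> \<and> touches_from_below \<Theta> \<phi> u \<xi> \<longrightarrow>
          (space_grad \<phi> \<xi> \<noteq> 0 \<longrightarrow> time_deriv \<phi> \<xi> - space_pq_laplacian p q \<phi> \<xi> \<ge> 0) \<and>
          (space_grad \<phi> \<xi> = 0 \<longrightarrow> time_deriv \<phi> \<xi> \<ge> 0))"

definition upper_class ::
    "real \<Rightarrow> real \<Rightarrow> ((real ^ 'n) \<times> real) set \<Rightarrow> ((real ^ 'n) \<times> real \<Rightarrow> real) \<Rightarrow>
     ((real ^ 'n) \<times> real \<Rightarrow> ereal) set" where
  "upper_class p q \<Theta> f = {u.
     viscosity_supersolution p q \<Theta> u \<and>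
     (\<exists>m :: real. \<forall>\<xi>\<in>\<Theta>. ereal m \<le> u \<xi>) \<and>
     (\<forall>\<xi>\<in>frontier \<Theta>. ereal (f \<xi>) \<le> Liminf (at \<xi> within \<Theta>) u)}"

definition upper_perron ::
    "real \<Rightarrow> real \<Rightarrow> ((real ^ 'n) \<times> real) set \<Rightarrow> ((real ^ 'n) \<times> real \<Rightarrow> real) \<Rightarrow>
     (real ^ 'n) \<times> real \<Rightarrow> ereal" where
  "upper_perron p q \<Theta> f \<xi> = (INF u\<in>upper_class p q \<Theta> f. u \<xi>)"

text \<open>For bounded \<open>\<Theta>\<close> the frontier is compact, so continuous boundary data are bounded.\<close>

definition regular_point ::
    "real \<Rightarrow> real \<Rightarrow> ((real ^ 'n) \<times> real) set \<Rightarrow> (real ^ 'n) \<times> real \<Rightarrow> bool" where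
  "regular_point p q \<Theta> \<xi>\<^sub>0 \<longleftrightarrow>
     \<xi>\<^sub>0 \<in> frontier \<Theta> \<and>
     (\<forall>f. continuous_on (frontier \<Theta>) f \<longrightarrow>
        (upper_perron p q \<Theta> f \<longlongrightarrow> ereal (f \<xi>\<^sub>0)) (at \<xi>\<^sub>0 within \<Theta>))"

end

(*
  With an integer m so large that 2m > q / (q - 1), the function |x - x0|^(2m) has bounded p,q-Laplacian
  near x0 and belongs, up to a factor, to the class of admissible radial functions. Near \<xi>0 = (x0, t0)
  the set lies in t >= t0, so on a small cylinder around \<xi>0 the barrier
    g(x,t) = A |x - x0|^(2m) + K (t - t0)
  is nonnegative and, for A and then K large, f(\<xi>0) + \<epsilon> + g is a classical supersolution and
  f(\<xi>0) - \<epsilon> - g a strict classical subsolution. On the part of the boundary of the cylinder inside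
  the set, g exceeds the oscillation of f. Truncating the former at max f + \<epsilon> and extending by that
  constant gives a member of the upper class; the latter lies below every member of the upper class
  by comparison at a minimum point of the difference.
*)

theory Submission
  imports Defs
begin

subsection \<open>The operator on radial powers\<close>

text \<open>For |x - x0|^(2m) the gradient has order r^(2m-1) and the Hessian r^(2m-2), so the
  operator has order r^((2m-1)(q-2) + 2m-2) = r^((2m-1)(q-1) - 1). This exponent is positive exactly
  when 2m > q/(q-1); the square of the distance would give q - 2, which is negative for q < 2. An
  even power is moreover a polynomial, hence smooth across the points where the equation is
  singular. The two estimates are asymmetric. An upper bound needs one member of the upper class,
  but a lower bound must hold for all members, which are only lower semicontinuous. One competitor
  is explicit and smooth, so it can itself be the test function, once shifted by a constant and
  lowered away from the contact point. The lowering must keep it admissible where the gradient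
  vanishes, so it uses the same power in x and a square in t. The boundary data give no information
  on the part of the cylinder's boundary inside the set. There the members of the upper class are
  controlled by a minimum principle, which is the same comparison with a function of time
  alone.\<close>

lemma grad_eqI:
  fixes u :: "real ^ 'n \<Rightarrow> real"
  assumes "(u has_derivative (\<lambda>h. g \<bullet> h)) (at x)"
  shows "grad u x = g"
  unfolding grad_def frechet_derivative_at[OF assms, symmetric]
  by (simp add: vec_eq_iff inner_axis)

text \<open>\<open>hess\<close> differentiates the function \<open>grad u\<close>, so the formula
  for the gradient must hold in a neighbourhood of \<open>x\<close> before \<open>G\<close> can be
  differentiated in its place.\<close>

lemma grad_hess_eqI:
  fixes u :: "real ^ 'n \<Rightarrow> real"
  assumes u: "\<forall>\<^sub>F y in nhds x. (u has_derivative (\<lambda>h. G y \<bullet> h)) (at y)"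
    and G: "(G has_derivative L) (at x)"
  shows "grad u x = G x" "(grad u has_derivative L) (at x)" "hess u x = matrix L"
proof -
  have ev: "\<forall>\<^sub>F y in nhds x. grad u y = G y"
    using u by eventually_elim (rule grad_eqI)
  then show x: "grad u x = G x"
    by (rule eventually_nhds_x_imp_x)
  show D: "(grad u has_derivative L) (at x)"
  proof (rule has_derivative_transform_eventually[OF G])
    show "\<forall>\<^sub>F y in at x. G y = grad u y"
      using ev unfolding eventually_at_filter by eventually_elim simp
  qed (use x in auto)
  show "hess u x = matrix L"
    unfolding hess_def jacobian_def frechet_derivative_at[OF D, symmetric] ..
qed

lemma pq_laplacian_eqI:
  fixes u :: "real ^ 'n \<Rightarrow> real"
  assumes "\<forall>\<^sub>F y in nhds x. (u has_derivative (\<lambda>h. G y \<bullet> h)) (at y)"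
    and "(G has_derivative L) (at x)" and "G x \<noteq> 0"
  shows "pq_laplacian p q u x = pq_op p q (G x) (matrix L)"
  using pq_laplacian_eq_pq_op[of u x p q] grad_hess_eqI[OF assms(1,2)] assms(3)
  by (auto simp: differentiable_def)

section \<open>Monotonicity of the operator in the Hessian\<close>

lemma linear_axis_expansion:
  fixes L :: "real ^ 'n \<Rightarrow> real ^ 'n"
  assumes "linear L"
  shows "L \<eta> = (\<Sum>i\<in>UNIV. \<eta> $ i *\<^sub>R L (axis i 1))"
proof -
  have "L (\<Sum>i\<in>UNIV. \<eta> $ i *\<^sub>R axis i 1) = (\<Sum>i\<in>UNIV. \<eta> $ i *\<^sub>R L (axis i 1))"
    by (simp only: linear_sum[OF assms] linear_scale[OF assms])
  then show ?thesis
    by (simp only: basis_expansion[of \<eta>, unfolded scalar_mult_eq_scaleR])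
qed

text \<open>The trace of (\<eta> \<eta>^T) X is the quadratic form of X at \<eta>, after exchanging
  two coordinate sums. The operator thus sees \<open>L\<close> only through its quadratic form,
  which is what a minimum controls.\<close>

lemma pq_op_matrix:
  fixes L :: "real ^ 'n \<Rightarrow> real ^ 'n"
  assumes "linear L"
  shows "pq_op p q \<eta> (matrix L) = norm \<eta> powr (q - 2) *
    ((\<Sum>i\<in>UNIV. axis i 1 \<bullet> L (axis i 1)) + (p - 2) / (norm \<eta>)\<^sup>2 * (\<eta> \<bullet> L \<eta>))"
proof -
  have "L \<eta> = (\<Sum>i\<in>UNIV. \<eta> $ i *\<^sub>R L (axis i 1))"
    by (rule linear_axis_expansion[OF assms])
  then have "\<eta> \<bullet> L \<eta> = (\<Sum>i\<in>UNIV. \<Sum>j\<in>UNIV. \<eta> $ i * (\<eta> $ j * L (axis j 1) $ i))"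
    by (simp add: inner_vec_def sum_distrib_left)
  also have "\<dots> = (\<Sum>i\<in>UNIV. \<Sum>j\<in>UNIV. \<eta> $ i * \<eta> $ j * L (axis i 1) $ j)"
    by (subst sum.swap) (simp add: mult_ac)
  finally show ?thesis
    by (simp add: pq_op_def trace_def matrix_def matrix_matrix_mult_def outer_prod_def sum.distrib
        sum_distrib_left divide_inverse mult_ac inner_axis')
qed

text \<open>With \<open>B = I + (sqrt (p - 1) - 1) \<eta>\<eta>\<^sup>T/|\<eta>|\<^sup>2\<close> the trace in \<open>pq_op\<close> equals that of \<open>B\<^sup>T X B\<close>.\<close>

lemma pq_op_nonneg:
  fixes L :: "real ^ 'n \<Rightarrow> real ^ 'n"
  assumes L: "linear L" and pos: "\<And>h. 0 \<le> h \<bullet> L h" and p: "p > 1" and nz: "\<eta> \<noteq> 0"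
  shows "0 \<le> pq_op p q \<eta> (matrix L)"
proof -
  define k where "k = (sqrt (p - 1) - 1) / (norm \<eta>)\<^sup>2"
  have n2: "(\<Sum>i\<in>UNIV. \<eta> $ i * \<eta> $ i) = (norm \<eta>)\<^sup>2"
    by (simp add: power2_norm_eq_inner inner_vec_def)
  \<comment> \<open>\<open>k\<close> solves (1 + k |\<eta>|^2)^2 = p - 1; the square root is where p
    > 1 enters.\<close>
  have k: "2 * k + k\<^sup>2 * (norm \<eta>)\<^sup>2 = (p - 2) / (norm \<eta>)\<^sup>2"
  proof -
    have "(sqrt (p - 1))\<^sup>2 = p - 1" using p by simp
    then have "2 * (sqrt (p - 1) - 1) + (sqrt (p - 1) - 1)\<^sup>2 = p - 2"
      by (simp add: power2_eq_square algebra_simps)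
    moreover have "2 * k + k\<^sup>2 * (norm \<eta>)\<^sup>2
      = (2 * (sqrt (p - 1) - 1) + (sqrt (p - 1) - 1)\<^sup>2) / (norm \<eta>)\<^sup>2"
      using nz by (simp add: k_def field_simps power2_eq_square)
    ultimately show ?thesis by simp
  qed
  have ex: "L \<eta> = (\<Sum>i\<in>UNIV. \<eta> $ i *\<^sub>R L (axis i 1))"
    by (rule linear_axis_expansion[OF L])
  have s1: "(\<Sum>i\<in>UNIV. \<eta> $ i * (\<eta> \<bullet> L (axis i 1))) = \<eta> \<bullet> L \<eta>"
    by (subst ex) (simp add: inner_sum_right)
  have s2: "(\<Sum>i\<in>UNIV. \<eta> $ i * (axis i 1 \<bullet> L \<eta>)) = \<eta> \<bullet> L \<eta>"
    by (subst inner_vec_def[of \<eta>]) (simp add: inner_axis')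
  \<comment> \<open>The vectors are the columns of B. Both cross terms sum to the form of
    \<open>L\<close> at \<eta>, by \<open>s1\<close> and \<open>s2\<close>.\<close>
  have "0 \<le> (\<Sum>i\<in>UNIV. (axis i 1 + (k * \<eta> $ i) *\<^sub>R \<eta>) \<bullet> L (axis i 1 + (k * \<eta> $ i) *\<^sub>R \<eta>))"
    by (intro sum_nonneg pos)
  also have "\<dots> = (\<Sum>i\<in>UNIV. axis i 1 \<bullet> L (axis i 1) + k * (\<eta> $ i * (axis i 1 \<bullet> L \<eta>))
      + k * (\<eta> $ i * (\<eta> \<bullet> L (axis i 1))) + k\<^sup>2 * (\<eta> \<bullet> L \<eta>) * (\<eta> $ i * \<eta> $ i))"
    by (intro sum.cong refl)
      (simp add: linear_add[OF L] linear_scale[OF L] inner_add_left inner_add_right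
        power2_eq_square algebra_simps)
  also have "\<dots> = (\<Sum>i\<in>UNIV. axis i 1 \<bullet> L (axis i 1)) + (2 * k + k\<^sup>2 * (norm \<eta>)\<^sup>2) * (\<eta> \<bullet> L \<eta>)"
    unfolding sum.distrib sum_distrib_left[symmetric] s1 s2 n2 by (simp add: algebra_simps)
  finally show ?thesis
    unfolding pq_op_matrix[OF L] k by simp
qed

text \<open>Degenerate ellipticity: for fixed \<eta> the operator is linear in the matrix, so
  positivity is applied to the difference of the two maps.\<close>

lemma pq_op_mono:
  fixes L :: "real ^ 'n \<Rightarrow> real ^ 'n"
  assumes L: "linear L" and L': "linear L'" and le: "\<And>h. h \<bullet> L h \<le> h \<bullet> L' h"
    and p: "p > 1" and nz: "\<eta> \<noteq> 0"
  shows "pq_op p q \<eta> (matrix L) \<le> pq_op p q \<eta> (matrix L')"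
proof -
  have lin: "linear (\<lambda>h. L' h - L h)" using L L' by (rule linear_compose_sub[rotated])
  have "0 \<le> pq_op p q \<eta> (matrix (\<lambda>h. L' h - L h))"
    by (rule pq_op_nonneg[OF lin _ p nz]) (simp add: inner_diff_right le)
  also have "\<dots> = pq_op p q \<eta> (matrix L') - pq_op p q \<eta> (matrix L)"
    unfolding pq_op_matrix[OF L] pq_op_matrix[OF L'] pq_op_matrix[OF lin]
    unfolding inner_diff_right sum_subtractf by (simp only: algebra_simps)
  finally show ?thesis by simp
qed

section \<open>Even powers of the distance\<close>

text \<open>A power of an inner product instead of a norm: this is a polynomial, so the centre needs
  no separate treatment in differentiation.\<close>

definition rpow :: "nat \<Rightarrow> 'a::real_inner \<Rightarrow> 'a \<Rightarrow> real" where
  "rpow m a x = ((x - a) \<bullet> (x - a)) ^ m"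

lemma rpow_norm: "rpow m a x = norm (x - a) ^ (2 * m)"
  by (simp add: rpow_def power_mult power2_norm_eq_inner)

lemma rpow_same: "m > 0 \<Longrightarrow> rpow m a a = 0"
  by (simp add: rpow_def)

lemma rpow_nonneg: "0 \<le> rpow m a x"
  by (simp add: rpow_def)

lemma rpow_pos: "x \<noteq> a \<Longrightarrow> 0 < rpow m a x"
  by (simp add: rpow_norm)

definition rgrad :: "nat \<Rightarrow> 'a::real_inner \<Rightarrow> 'a \<Rightarrow> 'a" where
  "rgrad m a x = (2 * real m * rpow (m - 1) a x) *\<^sub>R (x - a)"

text \<open>The truncated subtractions do no harm: for m = 0 and m = 1 the factors
  \<open>real m\<close> and \<open>real (m - 1)\<close> vanish.\<close>

definition rhess :: "nat \<Rightarrow> 'a::real_inner \<Rightarrow> 'a \<Rightarrow> 'a \<Rightarrow> 'a" where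
  "rhess m a x h = (2 * real m * rpow (m - 1) a x) *\<^sub>R h
     + (4 * real m * real (m - 1) * rpow (m - 2) a x * ((x - a) \<bullet> h)) *\<^sub>R (x - a)"

lemma rpow_has_derivative: "(rpow m a has_derivative (\<lambda>h. rgrad m a x \<bullet> h)) (at x)"
  unfolding rpow_def rgrad_def
  by (rule derivative_eq_intros refl)+ (simp add: fun_eq_iff inner_commute algebra_simps)

lemma rgrad_has_derivative: "(rgrad m a has_derivative rhess m a x) (at x)"
  unfolding rgrad_def[abs_def] rhess_def[abs_def]
  by (rule derivative_eq_intros rpow_has_derivative[unfolded rgrad_def] refl)+
    (simp add: fun_eq_iff algebra_simps numeral_2_eq_2)

lemma rgrad_same [simp]: "rgrad m a a = 0"
  by (simp add: rgrad_def)

lemma rgrad_nonzero: "m > 0 \<Longrightarrow> x \<noteq> a \<Longrightarrow> rgrad m a x \<noteq> 0"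
  using rpow_pos[of x a "m - 1"] by (simp add: rgrad_def)

lemma rhess_same: "m \<ge> 2 \<Longrightarrow> rhess m a a h = 0"
  by (simp add: rhess_def rpow_same)

text \<open>The second factor is n - 1 + (p - 1)(2m - 1): up to a common factor the Hessian has n -
  1 tangential eigenvalues 1 and the radial eigenvalue 2m - 1, which the operator weights with p -
  1. The first factor collects |gradient|^(q-2) and the common factor of the Hessian.\<close>

definition rconst :: "'n::finite itself \<Rightarrow> real \<Rightarrow> real \<Rightarrow> nat \<Rightarrow> real \<Rightarrow> real" where
  "rconst _ p q m A = (2 * real m * \<bar>A\<bar>) powr (q - 1)
     * (CARD('n) + (2 * real m - 2) + (p - 2) * (2 * real m - 1))"

lemma rconst_nonneg:
  assumes "p > 1" and "m > 0"
  shows "0 \<le> rconst TYPE('n::finite) p q m A"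
proof -
  have "0 \<le> (p - 1) * (2 * real m - 1)" using assms by simp
  moreover have "(p - 1) * (2 * real m - 1) = 1 + (2 * real m - 2) + (p - 2) * (2 * real m - 1)"
    by (simp add: algebra_simps)
  moreover have "1 \<le> real CARD('n)" by (simp add: Suc_leI)
  ultimately have "0 \<le> CARD('n) + (2 * real m - 2) + (p - 2) * (2 * real m - 1)"
    by linarith
  then show ?thesis by (simp add: rconst_def)
qed

text \<open>Gradient and Hessian share one scalar factor of order r^(2m-2), so the value is a pure
  power of r, with exponent (2m-1)(q-2) + (2m-2).\<close>

lemma pq_op_rpow:
  fixes a x :: "real ^ 'n"
  assumes m: "m \<ge> 2" and x: "x \<noteq> a" and A: "A \<noteq> 0"
  shows "pq_op p q (A *\<^sub>R rgrad m a x) (matrix (\<lambda>h. A *\<^sub>R rhess m a x h))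
   = sgn A * rconst TYPE('n) p q m A * norm (x - a) powr ((2 * real m - 1) * (q - 1) - 1)"
proof -
  define r where "r = norm (x - a)"
  define y where "y = x - a"
  define s where "s = A * (2 * real m * rpow (m - 1) a x)"
  \<comment> \<open>The gradient is \<open>s *\<^sub>R y\<close>, and \<open>L\<close> is the
    Hessian with the same factor \<open>s\<close> pulled out.\<close>
  define L where "L h = s *\<^sub>R h + (s * (2 * real (m - 1)) / r\<^sup>2 * (y \<bullet> h)) *\<^sub>R y" for h
  have r: "r > 0" using x by (simp add: r_def)
  have yy: "y \<bullet> y = r\<^sup>2" by (simp add: y_def r_def power2_norm_eq_inner)
  have ny: "norm y = r" by (simp add: y_def r_def)
  have rp: "rpow (m - 1) a x = rpow (m - 2) a x * r\<^sup>2"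
  proof -
    obtain k where "m = Suc (Suc k)" using m by (metis add_2_eq_Suc le_Suc_ex)
    then show ?thesis by (simp add: rpow_def r_def power2_norm_eq_inner)
  qed
  have Leq: "(\<lambda>h. A *\<^sub>R rhess m a x h) = L"
    unfolding L_def rhess_def s_def y_def[symmetric] fun_eq_iff rp using r
    by (simp add: scaleR_add_right mult_ac)
  have lin: "linear L"
    unfolding L_def by (intro linearI) (simp_all add: inner_add_right add_divide_distrib algebra_simps)
  have s0: "s \<noteq> 0" using A m x by (simp add: s_def rpow_norm)
  have yi: "(\<Sum>i\<in>UNIV. y $ i * y $ i) = r\<^sup>2" using yy by (simp add: inner_vec_def)
  have tr: "(\<Sum>i\<in>UNIV. axis i 1 \<bullet> L (axis i 1)) = s * (CARD('n) + 2 * real (m - 1))"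
  proof -
    have "(\<Sum>i\<in>UNIV. axis i 1 \<bullet> L (axis i 1))
      = (\<Sum>i\<in>(UNIV::'n set). s + s * (2 * real (m - 1)) / r\<^sup>2 * (y $ i * y $ i))"
      by (simp add: L_def inner_add_right inner_axis inner_axis' mult_ac)
    also have "\<dots> = s * CARD('n) + s * (2 * real (m - 1)) / r\<^sup>2 * r\<^sup>2"
      unfolding sum.distrib sum_distrib_left[symmetric] yi by simp
    finally show ?thesis using r by (simp add: algebra_simps)
  qed
  have q1: "(s *\<^sub>R y) \<bullet> L (s *\<^sub>R y) = s * (s * r)\<^sup>2 * (2 * real m - 1)"
    using r m by (simp add: L_def inner_add_right yy power2_eq_square of_nat_diff field_simps)
  have ns: "norm (s *\<^sub>R y) = \<bar>s\<bar> * r" by (simp add: ny)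
  have base: "pq_op p q (s *\<^sub>R y) (matrix L)
      = (\<bar>s\<bar> * r) powr (q - 2) * s * (CARD('n) + (2 * real m - 2) + (p - 2) * (2 * real m - 1))"
  proof -
    have "(p - 2) / (\<bar>s\<bar> * r)\<^sup>2 * (s * (s * r)\<^sup>2 * (2 * real m - 1)) = (p - 2) * s * (2 * real m - 1)"
      using s0 r by (simp add: power_mult_distrib)
    then show ?thesis
      unfolding pq_op_matrix[OF lin] tr q1 ns
      by (simp only:) (use m in \<open>simp add: of_nat_diff distrib_left distrib_right left_diff_distrib right_diff_distrib mult_ac\<close>)
  qed
  have sr: "rpow (m - 1) a x = r powr (2 * real m - 2)"
    using r m by (simp add: rpow_norm r_def of_nat_diff flip: powr_realpow)
  have s1: "s = sgn A * (2 * real m * \<bar>A\<bar>) * r powr (2 * real m - 2)"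
    unfolding s_def sr by (subst sgn_mult_abs[symmetric]) (simp only: mult_ac)
  have sabs: "\<bar>s\<bar> * r = (2 * real m * \<bar>A\<bar>) * r powr (2 * real m - 1)"
  proof -
    have "r powr (2 * real m - 1) = r powr (2 * real m - 2) * r"
      using r powr_add[of r "2 * real m - 2" 1] by simp
    then show ?thesis unfolding s_def sr by (simp add: abs_mult)
  qed
  have c0: "2 * real m * \<bar>A\<bar> > 0" using A m by simp
  have "(\<bar>s\<bar> * r) powr (q - 2) * s = sgn A * ((2 * real m * \<bar>A\<bar>) powr (q - 2) * (2 * real m * \<bar>A\<bar>))
     * ((r powr (2 * real m - 1)) powr (q - 2) * r powr (2 * real m - 2))"
    unfolding sabs by (subst s1) (use c0 r in \<open>simp add: powr_mult\<close>)
  also have "(2 * real m * \<bar>A\<bar>) powr (q - 2) * (2 * real m * \<bar>A\<bar>) = (2 * real m * \<bar>A\<bar>) powr (q - 1)"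
    using c0 powr_add[of "2 * real m * \<bar>A\<bar>" "q - 2" 1] by simp
  also have "(r powr (2 * real m - 1)) powr (q - 2) * r powr (2 * real m - 2)
     = r powr ((2 * real m - 1) * (q - 1) - 1)"
    by (simp add: powr_powr algebra_simps flip: powr_add)
  finally have "pq_op p q (s *\<^sub>R y) (matrix L) = sgn A * (2 * real m * \<bar>A\<bar>) powr (q - 1) *
     r powr ((2 * real m - 1) * (q - 1) - 1) * (CARD('n) + (2 * real m - 2) + (p - 2) * (2 * real m - 1))"
    unfolding base by simp
  then show ?thesis
    unfolding Leq rgrad_def rconst_def by (simp add: s_def y_def r_def mult_ac)
qed

subsection \<open>Twice continuously differentiable functions\<close>

lemma C2_onI:
  fixes \<phi> :: "'a::real_normed_vector \<Rightarrow> real"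
  assumes "\<And>z. z \<in> S \<Longrightarrow> (\<phi> has_derivative blinfun_apply (\<phi>' z)) (at z)"
    and "\<And>z. z \<in> S \<Longrightarrow> (\<phi>' has_derivative blinfun_apply (\<phi>'' z)) (at z)"
    and "continuous_on S \<phi>''"
  shows "C2_on S \<phi>"
  using assms unfolding C2_on_def by blast

lemma C2_on_const: "C2_on S (\<lambda>z. c)"
  by (rule C2_onI[where \<phi>' = "\<lambda>_. 0" and \<phi>'' = "\<lambda>_. 0"]) (auto simp: zero_blinfun.rep_eq)

lemma C2_on_bounded_linear:
  assumes "bounded_linear l"
  shows "C2_on S l"
proof (rule C2_onI[where \<phi>' = "\<lambda>_. Blinfun l" and \<phi>'' = "\<lambda>_. 0"])
  show "(l has_derivative blinfun_apply (Blinfun l)) (at z)" for z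
    using assms by (simp add: bounded_linear_Blinfun_apply bounded_linear_imp_has_derivative)
qed (auto simp: zero_blinfun.rep_eq)

lemma C2_on_add:
  assumes "C2_on S f" and "C2_on S g"
  shows "C2_on S (\<lambda>z. f z + g z)"
proof -
  obtain f' f'' g' g'' where
    "\<And>z. z \<in> S \<Longrightarrow> (f has_derivative blinfun_apply (f' z)) (at z)"
    "\<And>z. z \<in> S \<Longrightarrow> (f' has_derivative blinfun_apply (f'' z)) (at z)" "continuous_on S f''"
    "\<And>z. z \<in> S \<Longrightarrow> (g has_derivative blinfun_apply (g' z)) (at z)"
    "\<And>z. z \<in> S \<Longrightarrow> (g' has_derivative blinfun_apply (g'' z)) (at z)" "continuous_on S g''"
    using assms unfolding C2_on_def by metis
  then show ?thesis
    by (intro C2_onI[where \<phi>' = "\<lambda>z. f' z + g' z" and \<phi>'' = "\<lambda>z. f'' z + g'' z"])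
      (auto simp: plus_blinfun.rep_eq intro!: has_derivative_add continuous_intros)
qed

lemma C2_on_mult:
  assumes "C2_on S f" and "C2_on S g"
  shows "C2_on S (\<lambda>z. f z * g z)"
proof -
  obtain f' f'' g' g'' where
    f: "\<And>z. z \<in> S \<Longrightarrow> (f has_derivative blinfun_apply (f' z)) (at z)"
    "\<And>z. z \<in> S \<Longrightarrow> (f' has_derivative blinfun_apply (f'' z)) (at z)" "continuous_on S f''" and
    g: "\<And>z. z \<in> S \<Longrightarrow> (g has_derivative blinfun_apply (g' z)) (at z)"
    "\<And>z. z \<in> S \<Longrightarrow> (g' has_derivative blinfun_apply (g'' z)) (at z)" "continuous_on S g''"
    using assms unfolding C2_on_def by metis
  let ?D = "\<lambda>z. f z *\<^sub>R g'' z + (blinfun_scaleR_left (g' z) o\<^sub>L f' z)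
    + (g z *\<^sub>R f'' z + (blinfun_scaleR_left (f' z) o\<^sub>L g' z))"
  show ?thesis
  proof (rule C2_onI[where \<phi>' = "\<lambda>z. f z *\<^sub>R g' z + g z *\<^sub>R f' z" and \<phi>'' = ?D])
    fix z assume z: "z \<in> S"
    show "((\<lambda>z. f z * g z) has_derivative blinfun_apply (f z *\<^sub>R g' z + g z *\<^sub>R f' z)) (at z)"
      using has_derivative_mult[OF f(1)[OF z] g(1)[OF z]]
      by (simp add: plus_blinfun.rep_eq scaleR_blinfun.rep_eq mult_ac)
    show "((\<lambda>z. f z *\<^sub>R g' z + g z *\<^sub>R f' z) has_derivative blinfun_apply (?D z)) (at z)"
      using has_derivative_add[OF has_derivative_scaleR[OF f(1)[OF z] g(2)[OF z]]
          has_derivative_scaleR[OF g(1)[OF z] f(2)[OF z]]]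
      by (simp add: plus_blinfun.rep_eq scaleR_blinfun.rep_eq)
  next
    have c: "continuous_on S f" "continuous_on S f'" "continuous_on S g" "continuous_on S g'"
      by (rule has_derivative_continuous_on, rule has_derivative_at_withinI, rule f g, assumption)+
    show "continuous_on S ?D"
      by (intro continuous_intros c f(3) g(3)
          bounded_linear.continuous_on[OF bounded_linear_blinfun_scaleR_left])
  qed
qed

lemma C2_on_power: "C2_on S f \<Longrightarrow> C2_on S (\<lambda>z. f z ^ k)"
  by (induction k) (auto intro: C2_on_const C2_on_mult)

lemma C2_on_sum: "(\<And>i. i \<in> I \<Longrightarrow> C2_on S (f i)) \<Longrightarrow> C2_on S (\<lambda>z. \<Sum>i\<in>I. f i z)"
  by (induction I rule: infinite_finite_induct) (auto intro: C2_on_const C2_on_add)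

lemma C2_on_minus: "C2_on S f \<Longrightarrow> C2_on S (\<lambda>z. - f z)"
  using C2_on_mult[OF C2_on_const[of S "-1"]] by simp

lemma C2_on_diff: "C2_on S f \<Longrightarrow> C2_on S g \<Longrightarrow> C2_on S (\<lambda>z. f z - g z)"
  using C2_on_add[OF _ C2_on_minus] by simp

lemma C2_on_rpow_fst:
  fixes a :: "real ^ 'n"
  shows "C2_on S (\<lambda>z :: (real ^ 'n) \<times> real. rpow m a (fst z))"
proof -
  have "C2_on S (\<lambda>z :: (real ^ 'n) \<times> real. (\<Sum>i\<in>UNIV. (fst z $ i - a $ i)\<^sup>2) ^ m)"
    by (intro C2_on_power C2_on_sum C2_on_diff C2_on_const C2_on_bounded_linear
        bounded_linear_compose[OF bounded_linear_vec_nth bounded_linear_fst])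
  then show ?thesis
    by (simp add: rpow_def inner_vec_def power2_eq_square)
qed

lemma C2_on_snd: "C2_on S (\<lambda>z. snd z)"
  by (rule C2_on_bounded_linear[OF bounded_linear_snd])

text \<open>\<open>C2_on\<close> speaks of Frechet derivatives on space-time, while
  \<open>grad\<close>, \<open>hess\<close> and \<open>deriv\<close> act on slices. \<open>G\<close>
  represents the restriction of the first derivative to spatial directions, and \<open>L\<close>
  that of the second.\<close>

lemma C2_on_slices:
  fixes \<phi> :: "(real ^ 'n) \<times> real \<Rightarrow> real"
  assumes "C2_on S \<phi>" and "open S" and "(x, t) \<in> S"
  obtains G L where
    "\<forall>\<^sub>F y in nhds x. ((\<lambda>y. \<phi> (y, t)) has_derivative (\<lambda>h. G y \<bullet> h)) (at y)"
    "(G has_derivative L) (at x)"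
    "(\<lambda>s. \<phi> (x, s)) differentiable (at t)"
proof -
  obtain \<phi>' \<phi>'' where
    d1: "\<And>z. z \<in> S \<Longrightarrow> (\<phi> has_derivative blinfun_apply (\<phi>' z)) (at z)" and
    d2: "\<And>z. z \<in> S \<Longrightarrow> (\<phi>' has_derivative blinfun_apply (\<phi>'' z)) (at z)"
    using assms(1) unfolding C2_on_def by metis
  define G where "G y = (\<chi> i. blinfun_apply (\<phi>' (y, t)) (axis i 1, 0))" for y
  define L where "L h = (\<chi> i. blinfun_apply (blinfun_apply (\<phi>'' (x, t)) (h, 0)) (axis i 1, 0))" for h
  have G: "blinfun_apply (\<phi>' (y, t)) (h, 0) = G y \<bullet> h" for y h
  proof -
    interpret bounded_linear "\<lambda>h. blinfun_apply (\<phi>' (y, t)) (h, 0)"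
      by (intro bounded_linear_compose[OF blinfun.bounded_linear_right]
          bounded_linear_Pair bounded_linear_ident bounded_linear_zero)
    have "blinfun_apply (\<phi>' (y, t)) ((\<Sum>i\<in>UNIV. h $ i *\<^sub>R axis i 1), 0)
        = (\<Sum>i\<in>UNIV. h $ i * blinfun_apply (\<phi>' (y, t)) (axis i 1, 0))"
      unfolding sum scale by simp
    then show ?thesis
      unfolding basis_expansion[of h, unfolded scalar_mult_eq_scaleR]
      by (simp add: G_def inner_vec_def mult_ac)
  qed
  have "\<forall>\<^sub>F y in nhds x. (y, t) \<in> S"
  proof -
    have "open ((\<lambda>y. (y, t)) -` S)"
      using assms(2) by (intro open_vimage) (auto intro!: continuous_intros)
    then show ?thesis using assms(3) by (auto simp: eventually_nhds)
  qed
  then have "\<forall>\<^sub>F y in nhds x. ((\<lambda>y. \<phi> (y, t)) has_derivative (\<lambda>h. G y \<bullet> h)) (at y)"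
  proof eventually_elim
    case (elim y)
    have "((\<lambda>y. (y, t)) has_derivative (\<lambda>h. (h, 0))) (at y)"
      by (auto intro!: derivative_eq_intros)
    from has_derivative_compose[OF this d1[OF elim]] show ?case by (simp add: G)
  qed
  moreover have "(G has_derivative L) (at x)"
  proof -
    have "((\<lambda>y. (y, t)) has_derivative (\<lambda>h. (h, 0))) (at x)"
      by (auto intro!: derivative_eq_intros)
    from has_derivative_compose[OF this d2[OF assms(3)]]
    have D: "((\<lambda>y. \<phi>' (y, t)) has_derivative (\<lambda>h. blinfun_apply (\<phi>'' (x, t)) (h, 0))) (at x)" .
    then have "((\<lambda>y. blinfun_apply (\<phi>' (y, t)) v) has_derivative
        (\<lambda>h. blinfun_apply (blinfun_apply (\<phi>'' (x, t)) (h, 0)) v)) (at x)" for v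
      by (rule bounded_linear.has_derivative[OF blinfun.bounded_linear_left])
    then show ?thesis
      by (subst has_derivative_componentwise_within)
        (auto simp: Basis_vec_def inner_axis G_def L_def)
  qed
  moreover have "(\<lambda>s. \<phi> (x, s)) differentiable (at t)"
  proof -
    have "((\<lambda>s. (x, s)) has_derivative (\<lambda>h. (0, h))) (at t)"
      by (auto intro!: derivative_eq_intros)
    from has_derivative_compose[OF this d1[OF assms(3)]] show ?thesis
      by (auto simp: differentiable_def)
  qed
  ultimately show thesis by (rule that)
qed

text \<open>Restriction to the line through \<open>x\<close> in direction \<open>h\<close>: a
  negative second derivative at 0 makes the slope negative just to the right of 0, and the mean
  value theorem then pushes the function below its minimum.\<close>

lemma second_derivative_test:
  fixes d :: "'a::real_inner \<Rightarrow> real"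
  assumes d: "\<forall>\<^sub>F y in nhds x. (d has_derivative (\<lambda>h. D y \<bullet> h)) (at y)"
    and D: "(D has_derivative L) (at x)"
    and min: "\<forall>\<^sub>F y in nhds x. d x \<le> d y"
  shows "D x = 0" "0 \<le> h \<bullet> L h"
proof -
  have dx: "(d has_derivative (\<lambda>h. D x \<bullet> h)) (at x)"
    using d by (rule eventually_nhds_x_imp_x)
  have "(\<lambda>h. D x \<bullet> h) = (\<lambda>h. 0)"
    using min by (intro has_derivative_local_min[OF dx]) (auto simp: eventually_at_filter elim: eventually_mono)
  then show Dx: "D x = 0" by (metis inner_eq_zero_iff)
  define g where "g s = d (x + s *\<^sub>R h)" for s :: real
  define g' where "g' s = D (x + s *\<^sub>R h) \<bullet> h" for s :: real
  have lim: "filterlim (\<lambda>s::real. x + s *\<^sub>R h) (nhds x) (nhds 0)"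
    by (auto intro!: tendsto_eq_intros filterlim_ident)
  have "\<forall>\<^sub>F s in nhds 0. (g has_real_derivative g' s) (at s)"
    using eventually_compose_filterlim[OF d lim]
  proof eventually_elim
    case (elim s)
    have "((\<lambda>s. x + s *\<^sub>R h) has_derivative (\<lambda>k. k *\<^sub>R h)) (at s)"
      by (auto intro!: derivative_eq_intros)
    from has_derivative_compose[OF this elim] show ?case
      unfolding has_field_derivative_def g_def g'_def
      by (simp add: mult_commute_abs)
  qed
  moreover have "\<forall>\<^sub>F s in nhds 0. g 0 \<le> g s"
    using eventually_compose_filterlim[OF min lim] by (simp add: g_def)
  ultimately have "\<forall>\<^sub>F s in nhds 0. (g has_real_derivative g' s) (at s) \<and> g 0 \<le> g s"
    by (intro eventually_conj)
  then obtain e where e: "e > 0"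
    and g: "\<And>s. \<bar>s\<bar> < e \<Longrightarrow> (g has_real_derivative g' s) (at s)" "\<And>s. \<bar>s\<bar> < e \<Longrightarrow> g 0 \<le> g s"
    unfolding eventually_nhds_metric dist_real_def diff_0_right by blast
  have g'': "(g' has_real_derivative h \<bullet> L h) (at 0)"
  proof -
    have "((\<lambda>s. x + s *\<^sub>R h) has_derivative (\<lambda>k. k *\<^sub>R h)) (at 0)"
      by (auto intro!: derivative_eq_intros)
    from has_derivative_compose[OF this, of D L] D
    have "((\<lambda>s. D (x + s *\<^sub>R h)) has_derivative (\<lambda>k. L (k *\<^sub>R h))) (at 0)" by simp
    from has_derivative_inner_left[OF this, of h] show ?thesis
      unfolding has_field_derivative_def g'_def
      by (simp add: linear_scale[OF has_derivative_linear[OF D]] inner_commute mult_commute_abs)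
  qed
  show "0 \<le> h \<bullet> L h"
  proof (rule ccontr)
    assume "\<not> 0 \<le> h \<bullet> L h"
    then have "h \<bullet> L h < 0" by simp
    from DERIV_neg_dec_right[OF g'' this] Dx obtain k where
      k: "k > 0" "\<And>s. 0 < s \<Longrightarrow> s < k \<Longrightarrow> g' s < 0"
      by (auto simp: g'_def)
    define b where "b = min e k / 2"
    have b: "0 < b" "b < e" "b < k" using e k(1) by (auto simp: b_def)
    obtain z where "0 < z" "z < b" "g b - g 0 = (b - 0) * g' z"
      using MVT2[of 0 b g g'] b g(1) by auto
    with k(2)[of z] b have "g b < g 0"
      by (smt (verit) mult_pos_neg)
    with g(2)[of b] b show False by simp
  qed
qed

subsection \<open>Comparison with strict classical subsolutions\<close>

text \<open>Two centres, because a test function combines the barrier centred at \<open>a\<close>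
  with a correction centred at the contact point \<open>b\<close>; B = 0 gives the barrier
  alone.\<close>

lemma rpow_sum_has_derivative:
  "((\<lambda>x. A * rpow m a x + B * rpow m b x + c) has_derivative
     (\<lambda>h. (A *\<^sub>R rgrad m a x + B *\<^sub>R rgrad m b x) \<bullet> h)) (at x)"
  by (rule derivative_eq_intros rpow_has_derivative refl)+ (simp add: fun_eq_iff inner_add_left)

lemma rgrad_sum_has_derivative:
  "((\<lambda>x. A *\<^sub>R rgrad m a x + B *\<^sub>R rgrad m b x) has_derivative
     (\<lambda>h. A *\<^sub>R rhess m a x h + B *\<^sub>R rhess m b x h)) (at x)"
  by (intro has_derivative_add has_derivative_scaleR_right rgrad_has_derivative)

text \<open>m \<ge> 2 makes the second derivative vanish at 0, and \<open>e\<close> makes the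
  exponent in \<open>pq_op_rpow\<close> positive, so that the operator tends to 0 at the
  centre.\<close>

lemma power_in_F_class:
  assumes m: "m \<ge> 2" and e: "(2 * real m - 1) * (q - 1) > 1" and A: "A > 0"
  shows "(\<lambda>r. A * r ^ (2 * m)) \<in> F_class TYPE('n::finite) p q"
proof -
  define f' where "f' r = A * (2 * real m) * r ^ (2 * m - 1)" for r :: real
  define f'' where "f'' r = A * (2 * real m) * (2 * real m - 1) * r ^ (2 * m - 2)" for r :: real
  have "((\<lambda>r. A * r ^ (2 * m)) has_real_derivative f' r) (at r within {0..})" for r
    unfolding f'_def by (rule derivative_eq_intros refl)+ simp
  moreover have "(f' has_real_derivative f'' r) (at r within {0..})" for r
    unfolding f'_def[abs_def] f''_def using m
    by (auto intro!: derivative_eq_intros simp: of_nat_diff numeral_2_eq_2)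
  moreover have "continuous_on {0..} f''"
    unfolding f''_def[abs_def] by (intro continuous_intros)
  moreover have "A * 0 ^ (2 * m) = 0" "f' 0 = 0" "f'' 0 = 0"
    using m by (auto simp: f'_def f''_def)
  moreover have "f'' r > 0" if "r > 0" for r
    using A m that by (simp add: f''_def)
  moreover have "((\<lambda>x :: real ^ 'n. pq_op p q (grad (\<lambda>y. A * norm y ^ (2 * m)) x)
      (hess (\<lambda>y. A * norm y ^ (2 * m)) x)) \<longlongrightarrow> 0) (at 0)"
  proof -
    let ?e = "(2 * real m - 1) * (q - 1) - 1"
    have eq: "(\<lambda>y :: real ^ 'n. A * norm y ^ (2 * m)) = (\<lambda>y. A * rpow m 0 y + 0 * rpow m 0 y + 0)"
      by (simp add: rpow_norm)
    have "\<forall>\<^sub>F y in nhds x. ((\<lambda>y :: real ^ 'n. A * norm y ^ (2 * m)) has_derivative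
        (\<lambda>h. (A *\<^sub>R rgrad m 0 y + 0 *\<^sub>R rgrad m 0 y) \<bullet> h)) (at y)" for x
      unfolding eq by (intro always_eventually allI rpow_sum_has_derivative)
    note gh = grad_hess_eqI[OF this rgrad_sum_has_derivative]
    have "pq_op p q (grad (\<lambda>y. A * norm y ^ (2 * m)) x) (hess (\<lambda>y. A * norm y ^ (2 * m)) x)
        = rconst TYPE('n) p q m A * norm x powr ?e" if "x \<noteq> 0" for x :: "real ^ 'n"
      using pq_op_rpow[OF m that, of A p q] A by (simp add: gh)
    then have "\<forall>\<^sub>F x :: real ^ 'n in at 0. rconst TYPE('n) p q m A * norm x powr ?e =
       pq_op p q (grad (\<lambda>y. A * norm y ^ (2 * m)) x) (hess (\<lambda>y. A * norm y ^ (2 * m)) x)"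
      by (auto simp: eventually_at_filter)
    moreover have "((\<lambda>x :: real ^ 'n. rconst TYPE('n) p q m A * norm x powr ?e) \<longlongrightarrow> 0) (at 0)"
    proof -
      have "((\<lambda>x :: real ^ 'n. norm x powr ?e) \<longlongrightarrow> 0) (at 0)"
        using e by (intro tendsto_zero_powrI[where b = ?e])
          (auto intro!: tendsto_eq_intros always_eventually)
      from tendsto_mult_right_zero[OF this] show ?thesis .
    qed
    ultimately show ?thesis by (rule Lim_transform_eventually[rotated])
  qed
  ultimately show ?thesis
    unfolding F_class_def by blast
qed

lemma square_in_Sigma_class: "(\<lambda>s. s\<^sup>2) \<in> Sigma_class"
proof -
  have d: "((\<lambda>s::real. s\<^sup>2) has_real_derivative 2 * s) (at s)" for s
    by (auto intro!: derivative_eq_intros)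
  have "(\<lambda>s::real. s\<^sup>2) C1_differentiable_on UNIV"
    unfolding C1_differentiable_on_def
    by (rule exI[of _ "\<lambda>s. 2 * s"])
      (auto intro!: continuous_intros d[unfolded has_real_derivative_iff_has_vector_derivative])
  moreover have "deriv (\<lambda>s::real. s\<^sup>2) 0 = 0"
    using DERIV_imp_deriv[OF d[of 0]] by simp
  ultimately show ?thesis by (auto simp: Sigma_class_def)
qed

text \<open>The two terms centred at \<open>(b, \<tau>)\<close> only make the contact strict: for \<open>m \<ge> 2\<close> they do not
  contribute to the first and second derivatives in \<open>x\<close> nor to the time derivative there.\<close>

lemma test_function:
  fixes a b :: "real ^ 'n" and A K s c \<tau> :: real
  assumes m: "m \<ge> 2" and e: "(2 * real m - 1) * (q - 1) > 1"
  defines "\<phi> \<equiv> \<lambda>z. A * rpow m a (fst z) + K * (snd z - s) + c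
      - (rpow m b (fst z) + (snd z - \<tau>)\<^sup>2)"
  shows "C2_on S \<phi>"
    and "space_grad \<phi> (b, \<tau>) = A *\<^sub>R rgrad m a b"
    and "time_deriv \<phi> (b, \<tau>) = K"
    and "A \<noteq> 0 \<Longrightarrow> b \<noteq> a \<Longrightarrow> space_pq_laplacian p q \<phi> (b, \<tau>)
      = sgn A * rconst TYPE('n) p q m A * norm (b - a) powr ((2 * real m - 1) * (q - 1) - 1)"
    and "admissible_at p q \<phi> (b, \<tau>)"
proof -
  show "C2_on S \<phi>"
    unfolding \<phi>_def power2_eq_square
    by (intro C2_on_diff C2_on_add C2_on_mult C2_on_const C2_on_snd C2_on_rpow_fst)
  have eq: "(\<lambda>y. \<phi> (y, \<tau>)) = (\<lambda>x. A * rpow m a x + (- 1) * rpow m b x + (K * (\<tau> - s) + c))"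
    by (simp add: \<phi>_def algebra_simps)
  have 1: "\<forall>\<^sub>F y in nhds b. ((\<lambda>y. \<phi> (y, \<tau>)) has_derivative
        (\<lambda>h. (A *\<^sub>R rgrad m a y + (- 1) *\<^sub>R rgrad m b y) \<bullet> h)) (at y)"
    unfolding eq by (intro always_eventually allI rpow_sum_has_derivative)
  show sg: "space_grad \<phi> (b, \<tau>) = A *\<^sub>R rgrad m a b"
    by (simp add: space_grad_def grad_hess_eqI[OF 1 rgrad_sum_has_derivative])
  have "((\<lambda>s. \<phi> (b, s)) has_real_derivative K) (at \<tau>)"
    unfolding \<phi>_def by (auto intro!: derivative_eq_intros)
  then show td: "time_deriv \<phi> (b, \<tau>) = K"
    by (simp add: time_deriv_def DERIV_imp_deriv)
  have nz: "A *\<^sub>R rgrad m a b \<noteq> 0" if "A \<noteq> 0" "b \<noteq> a"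
    using rgrad_nonzero[OF _ that(2), of m] m that by simp
  {
    assume A: "A \<noteq> 0" and b: "b \<noteq> a"
    have "A *\<^sub>R rgrad m a b + (- 1) *\<^sub>R rgrad m b b \<noteq> 0"
      using nz[OF A b] by simp
    from pq_laplacian_eqI[OF 1 rgrad_sum_has_derivative this]
    show "space_pq_laplacian p q \<phi> (b, \<tau>)
      = sgn A * rconst TYPE('n) p q m A * norm (b - a) powr ((2 * real m - 1) * (q - 1) - 1)"
      using pq_op_rpow[OF m b A] by (simp add: space_pq_laplacian_def rhess_same[OF m])
  }
  show "admissible_at p q \<phi> (b, \<tau>)"
  proof (cases "A \<noteq> 0 \<and> b \<noteq> a")
    case True
    then show ?thesis using nz by (simp add: admissible_at_def sg)
  next
    case False
    \<comment> \<open>The gradient vanishes at \<open>b\<close> either because A = 0 or because the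
      centres coincide; in both cases the barrier varies around \<open>b\<close> like a multiple of
      \<open>rpow m b\<close>.\<close>
    then have ab: "A * rpow m a x - A * rpow m a b = A * rpow m b x" for x
      using m by (auto simp: rpow_same)
    have "\<bar>\<phi> (x, t) - \<phi> (b, \<tau>) - time_deriv \<phi> (b, \<tau>) * (t - \<tau>)\<bar>
        \<le> (\<bar>A\<bar> + 1) * norm (x - b) ^ (2 * m) + (t - \<tau>)\<^sup>2" for x t
    proof -
      have "\<phi> (x, t) - \<phi> (b, \<tau>) - time_deriv \<phi> (b, \<tau>) * (t - \<tau>)
        = (A * rpow m a x - A * rpow m a b) - rpow m b x - (t - \<tau>)\<^sup>2"
        using m by (simp add: td) (simp add: \<phi>_def rpow_same algebra_simps)
      also have "\<dots> = A * rpow m b x - rpow m b x - (t - \<tau>)\<^sup>2"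
        unfolding ab ..
      also have "\<bar>\<dots>\<bar> \<le> \<bar>A * rpow m b x\<bar> + \<bar>rpow m b x\<bar> + \<bar>(t - \<tau>)\<^sup>2\<bar>"
        by linarith
      also have "\<dots> = (\<bar>A\<bar> + 1) * norm (x - b) ^ (2 * m) + (t - \<tau>)\<^sup>2"
        by (simp add: abs_mult rpow_norm algebra_simps)
      finally show ?thesis .
    qed
    \<comment> \<open>The summand 1 accounts for the correction term and keeps the coefficient
      positive when A = 0.\<close>
    moreover have "(\<lambda>r. (\<bar>A\<bar> + 1) * r ^ (2 * m)) \<in> F_class TYPE('n) p q"
      using m e by (intro power_in_F_class) auto
    ultimately show ?thesis
      unfolding admissible_at_def prod.case using square_in_Sigma_class
      by (intro disjI2 exI[of _ 1] conjI bexI[of _ "\<lambda>r. (\<bar>A\<bar> + 1) * r ^ (2 * m)"]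
          bexI[of _ "\<lambda>s. s\<^sup>2"] ballI) auto
  qed
qed

text \<open>If the infimum of u - w over the part of \<Theta> in \<open>C\<close> is negative, a
  minimizing sequence accumulates at some \<open>l\<close> in \<open>C\<close>. The boundary
  hypotheses exclude the frontier of \<Theta> and that of \<open>C\<close>, and in the interior the
  test function from \<open>sub\<close> touches \<open>u\<close> at \<open>l\<close>. The constant
  \<open>c\<close> in \<open>sub\<close> is there because the minimal value is not known in
  advance.\<close>

lemma comparison:
  fixes u :: "(real ^ 'n) \<times> real \<Rightarrow> ereal"
  assumes u: "viscosity_supersolution p q \<Theta> u" and bnd: "\<And>\<xi>. \<xi> \<in> \<Theta> \<Longrightarrow> ereal k \<le> u \<xi>"
    and \<Theta>: "open \<Theta>" and C: "compact C" and w: "continuous_on UNIV w"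
    and bd1: "\<And>\<xi>. \<xi> \<in> frontier \<Theta> \<Longrightarrow> \<xi> \<in> C \<Longrightarrow> ereal (w \<xi>) \<le> Liminf (at \<xi> within \<Theta>) u"
    and bd2: "\<And>\<xi>. \<xi> \<in> \<Theta> \<Longrightarrow> \<xi> \<in> C \<Longrightarrow> \<xi> \<notin> interior C \<Longrightarrow> ereal (w \<xi>) \<le> u \<xi>"
    and sub: "\<And>\<xi> c. \<xi> \<in> \<Theta> \<Longrightarrow> \<xi> \<in> interior C \<Longrightarrow> \<exists>\<phi>. C2_on \<Theta> \<phi> \<and> admissible_at p q \<phi> \<xi> \<and>
        \<phi> \<xi> = w \<xi> + c \<and> (\<forall>\<eta>. \<eta> \<noteq> \<xi> \<longrightarrow> \<phi> \<eta> < w \<eta> + c) \<and>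
        (space_grad \<phi> \<xi> \<noteq> 0 \<longrightarrow> time_deriv \<phi> \<xi> - space_pq_laplacian p q \<phi> \<xi> < 0) \<and>
        (space_grad \<phi> \<xi> = 0 \<longrightarrow> time_deriv \<phi> \<xi> < 0)"
    and z: "z \<in> \<Theta>" "z \<in> C"
  shows "ereal (w z) \<le> u z"
proof (rule ccontr)
  assume "\<not> ereal (w z) \<le> u z"
  then have neg: "u z - ereal (w z) < 0"
    by (cases "u z") auto
  define D where "D = (\<lambda>\<xi>. u \<xi> - ereal (w \<xi>)) ` (\<Theta> \<inter> C)"
  obtain B where B: "\<And>\<xi>. \<xi> \<in> C \<Longrightarrow> w \<xi> \<le> B"
  proof -
    have "compact (w ` C)" using w C by (intro compact_continuous_image) (auto intro: continuous_on_subset)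
    then show thesis using that compact_imp_bounded bounded_has_Sup(1)[of "w ` C"]
      by (metis C all_not_in_conv image_eqI image_is_empty)
  qed
  have "ereal (k - B) \<le> d" if "d \<in> D" for d
  proof -
    obtain \<xi> where "\<xi> \<in> \<Theta>" "\<xi> \<in> C" "d = u \<xi> - ereal (w \<xi>)" using \<open>d \<in> D\<close> unfolding D_def by blast
    with bnd[of \<xi>] B[of \<xi>] show ?thesis by (cases "u \<xi>") auto
  qed
  then have "ereal (k - B) \<le> Inf D" by (rule Inf_greatest)
  moreover have infD: "Inf D < 0"
    using neg z by (auto simp: D_def intro!: INF_lower2[THEN order.strict_trans1])
  ultimately obtain \<mu> where \<mu>: "Inf D = ereal \<mu>" "\<mu> < 0"
    by (cases "Inf D") auto
  obtain d where d: "\<And>n. d n \<in> D" "d \<longlonglongrightarrow> ereal \<mu>"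
    using Inf_as_limit[of D] z \<mu> by (auto simp: D_def)
  then have "\<forall>n. \<exists>\<xi>. \<xi> \<in> \<Theta> \<inter> C \<and> d n = u \<xi> - ereal (w \<xi>)"
    using d(1) unfolding D_def by blast
  then obtain \<xi> where \<xi>: "\<And>n. \<xi> n \<in> \<Theta>" "\<And>n. \<xi> n \<in> C" "\<And>n. d n = u (\<xi> n) - ereal (w (\<xi> n))"
    by (metis IntE)
  obtain l r where l: "l \<in> C" "strict_mono r" "(\<xi> \<circ> r) \<longlonglongrightarrow> l"
    using C \<xi>(2) unfolding compact_def by metis
  have lcl: "l \<in> closure \<Theta>"
    unfolding closure_sequential using l(3) \<xi>(1) by (intro exI[of _ "\<xi> \<circ> r"]) auto
  have ul: "(\<lambda>n. u (\<xi> (r n))) \<longlonglongrightarrow> ereal (\<mu> + w l)"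
  proof -
    have "(\<lambda>n. d (r n)) \<longlonglongrightarrow> ereal \<mu>"
      using LIMSEQ_subseq_LIMSEQ[OF d(2) l(2)] by (simp add: o_def)
    moreover have "(\<lambda>n. ereal (w (\<xi> (r n)))) \<longlonglongrightarrow> ereal (w l)"
      using continuous_on_tendsto_compose[OF w l(3)] by (simp add: o_def)
    ultimately have "(\<lambda>n. d (r n) + ereal (w (\<xi> (r n)))) \<longlonglongrightarrow> ereal \<mu> + ereal (w l)"
      by (intro tendsto_add_ereal) auto
    moreover have "d (r n) + ereal (w (\<xi> (r n))) = u (\<xi> (r n))" for n
      unfolding \<xi>(3) by (cases "u (\<xi> (r n))") auto
    ultimately show ?thesis by simp
  qed
  \<comment> \<open>\<open>at l\<close> is punctured, but the sequence may hit \<open>l\<close>;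
    hence the second condition on \<open>y\<close>, which is void when \<open>l\<close> lies on the
    frontier.\<close>
  have key: "y \<le> ereal (\<mu> + w l)"
    if y: "y \<le> Liminf (at l within \<Theta>) u" "l \<in> \<Theta> \<Longrightarrow> y \<le> u l" for y
  proof (rule dense_le)
    fix y' assume y': "y' < y"
    then have "\<forall>\<^sub>F \<eta> in at l within \<Theta>. y' < u \<eta>"
      using y(1) by (simp add: le_Liminf_iff)
    then have "\<forall>\<^sub>F \<eta> in nhds l. \<eta> \<in> \<Theta> \<longrightarrow> y' < u \<eta>"
      unfolding eventually_at_filter
      by eventually_elim (use y(2) y' in \<open>auto intro: less_le_trans\<close>)
    then have "\<forall>\<^sub>F n in sequentially. \<xi> (r n) \<in> \<Theta> \<longrightarrow> y' < u (\<xi> (r n))"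
      using l(3) by (auto simp: o_def dest: eventually_compose_filterlim)
    then have "\<forall>\<^sub>F n in sequentially. y' \<le> u (\<xi> (r n))"
      by eventually_elim (use \<xi>(1) in auto)
    then show "y' \<le> ereal (\<mu> + w l)"
      by (rule tendsto_lowerbound[OF ul]) simp
  qed
  show False
  proof (cases "l \<in> \<Theta>")
    case False
    then have "l \<in> frontier \<Theta>" using lcl \<Theta> by (simp add: frontier_def interior_open)
    from key[OF bd1[OF this l(1)]] False \<mu>(2) show False by simp
  next
    case True
    have lsc: "u l \<le> Liminf (at l within \<Theta>) u"
      using u True by (auto simp: viscosity_supersolution_def)
    have le: "u l \<le> ereal (\<mu> + w l)" by (rule key[OF lsc]) simp
    have min: "ereal (w \<eta> + \<mu>) \<le> u \<eta>" if "\<eta> \<in> \<Theta>" "\<eta> \<in> C" for \<eta>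
    proof -
      have "ereal \<mu> \<le> u \<eta> - ereal (w \<eta>)"
        unfolding \<mu>(1)[symmetric] using that by (auto simp: D_def intro: INF_lower)
      then show ?thesis by (cases "u \<eta>") auto
    qed
    have li: "l \<in> interior C"
    proof (rule ccontr)
      assume "l \<notin> interior C"
      from bd2[OF True l(1) this] have "ereal (w l) \<le> ereal (\<mu> + w l)" using le by (rule order_trans)
      then show False using \<mu>(2) by simp
    qed
    have eq: "u l = ereal (w l + \<mu>)"
      using le min[OF True l(1)] by (simp add: add.commute)
    obtain \<phi> where \<phi>: "C2_on \<Theta> \<phi>" "admissible_at p q \<phi> l" "\<phi> l = w l + \<mu>"
        "\<And>\<eta>. \<eta> \<noteq> l \<Longrightarrow> \<phi> \<eta> < w \<eta> + \<mu>"
        "space_grad \<phi> l \<noteq> 0 \<longrightarrow> time_deriv \<phi> l - space_pq_laplacian p q \<phi> l < 0"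
        "space_grad \<phi> l = 0 \<longrightarrow> time_deriv \<phi> l < 0"
      using sub[OF True li, of \<mu>] by blast
    have "\<forall>\<^sub>F \<eta> in at l within \<Theta>. ereal (\<phi> \<eta>) < u \<eta>"
      unfolding eventually_at_filter
    proof (rule eventually_mono)
      show "\<forall>\<^sub>F \<eta> in nhds l. \<eta> \<in> interior C"
        using li by (intro eventually_nhds_in_open) auto
      fix \<eta> assume "\<eta> \<in> interior C"
      then have "\<eta> \<in> C" using interior_subset by blast
      then show "\<eta> \<noteq> l \<longrightarrow> \<eta> \<in> \<Theta> \<longrightarrow> ereal (\<phi> \<eta>) < u \<eta>"
        using \<phi>(4)[of \<eta>] min[of \<eta>] by (auto intro: less_le_trans[of _ "ereal (w \<eta> + \<mu>)"])
    qed
    then have "touches_from_below \<Theta> \<phi> u l"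
      using eq \<phi>(3) by (simp add: touches_from_below_def)
    with u True \<phi>(1,2) have
      "space_grad \<phi> l \<noteq> 0 \<longrightarrow> time_deriv \<phi> l - space_pq_laplacian p q \<phi> l \<ge> 0"
      "space_grad \<phi> l = 0 \<longrightarrow> time_deriv \<phi> l \<ge> 0"
      unfolding viscosity_supersolution_def by blast+
    with \<phi>(5,6) show False by linarith
  qed
qed

lemma rpow_continuous_on: "continuous_on S (\<lambda>z. rpow m a (fst z))"
  unfolding rpow_def by (intro continuous_intros)

text \<open>\<open>w\<close> has time derivative -K and operator value at least -K, strictly, by
  \<open>K'\<close>; hence it is a strict subsolution. The case A = 0, a function of time alone, is
  included for the minimum principle.\<close>

lemma radial_comparison:
  fixes u :: "(real ^ 'n) \<times> real \<Rightarrow> ereal" and a :: "real ^ 'n" and A K c s :: real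
  assumes p: "p > 1" and m: "m \<ge> 2" and e: "(2 * real m - 1) * (q - 1) > 1"
    and u: "viscosity_supersolution p q \<Theta> u" and bnd: "\<And>\<xi>. \<xi> \<in> \<Theta> \<Longrightarrow> ereal k \<le> u \<xi>"
    and \<Theta>: "open \<Theta>" and C: "compact C" and A: "A \<ge> 0" and K: "K > 0"
    and K': "\<And>x t. A \<noteq> 0 \<Longrightarrow> (x, t) \<in> C \<Longrightarrow>
      rconst TYPE('n) p q m A * norm (x - a) powr ((2 * real m - 1) * (q - 1) - 1) < K"
  defines "w \<equiv> \<lambda>z. c - A * rpow m a (fst z) - K * (snd z - s)"
  assumes bd1: "\<And>\<xi>. \<xi> \<in> frontier \<Theta> \<Longrightarrow> \<xi> \<in> C \<Longrightarrow> ereal (w \<xi>) \<le> Liminf (at \<xi> within \<Theta>) u"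
    and bd2: "\<And>\<xi>. \<xi> \<in> \<Theta> \<Longrightarrow> \<xi> \<in> C \<Longrightarrow> \<xi> \<notin> interior C \<Longrightarrow> ereal (w \<xi>) \<le> u \<xi>"
    and z: "z \<in> \<Theta>" "z \<in> C"
  shows "ereal (w z) \<le> u z"
proof (rule comparison[OF u bnd \<Theta> C _ bd1 bd2 _ z])
  show "continuous_on UNIV w"
    unfolding w_def by (intro continuous_intros rpow_continuous_on)
next
  fix \<xi> c' assume \<xi>: "\<xi> \<in> \<Theta>" "\<xi> \<in> interior C"
  obtain b \<tau> where b: "\<xi> = (b, \<tau>)" by (cases \<xi>)
  \<comment> \<open>This is w + c' lowered away from (b, \<tau>), so that the contact is
    strict.\<close>
  define \<phi> where "\<phi> = (\<lambda>z. (- A) * rpow m a (fst z) + (- K) * (snd z - s) + (c + c')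
      - (rpow m b (fst z) + (snd z - \<tau>)\<^sup>2))"
  note tf = test_function[OF m e, where A = "- A" and K = "- K" and c = "c + c'" and s = s
      and a = a and b = b and \<tau> = \<tau>, folded \<phi>_def b]
  have "\<phi> \<xi> = w \<xi> + c'"
    using m by (simp add: \<phi>_def w_def b rpow_same)
  moreover have "\<phi> \<eta> < w \<eta> + c'" if "\<eta> \<noteq> \<xi>" for \<eta>
  proof -
    have "0 < rpow m b (fst \<eta>) + (snd \<eta> - \<tau>)\<^sup>2"
    proof (cases "fst \<eta> = b")
      case True
      then have "snd \<eta> \<noteq> \<tau>" using that b by (metis prod.collapse)
      then show ?thesis using rpow_nonneg[of m b "fst \<eta>"] by (simp add: add_nonneg_pos)
    next
      case False
      then show ?thesis using rpow_pos[of "fst \<eta>" b m] by (simp add: add_pos_nonneg)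
    qed
    then show ?thesis by (simp add: \<phi>_def w_def)
  qed
  moreover have "time_deriv \<phi> \<xi> - space_pq_laplacian p q \<phi> \<xi> < 0" if nz: "space_grad \<phi> \<xi> \<noteq> 0"
  proof -
    have Ab: "A \<noteq> 0" "b \<noteq> a" using nz tf(2) by auto
    have "(b, \<tau>) \<in> C" using \<xi>(2) b interior_subset by blast
    from K'[OF Ab(1) this] show ?thesis
      using tf(3) tf(4)[of p] Ab A by (simp add: rconst_def)
  qed
  moreover have "time_deriv \<phi> \<xi> < 0" using K tf(3) by simp
  ultimately show "\<exists>\<phi>. C2_on \<Theta> \<phi> \<and> admissible_at p q \<phi> \<xi> \<and>
        \<phi> \<xi> = w \<xi> + c' \<and> (\<forall>\<eta>. \<eta> \<noteq> \<xi> \<longrightarrow> \<phi> \<eta> < w \<eta> + c') \<and>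
        (space_grad \<phi> \<xi> \<noteq> 0 \<longrightarrow> time_deriv \<phi> \<xi> - space_pq_laplacian p q \<phi> \<xi> < 0) \<and>
        (space_grad \<phi> \<xi> = 0 \<longrightarrow> time_deriv \<phi> \<xi> < 0)"
    using tf(1)[of \<Theta>] tf(5)[of p] by blast
qed

text \<open>Comparison with M - K (t + R). The small tilt in time makes the constant M a strict
  subsolution and costs at most \<epsilon>.\<close>

lemma supersolution_lower_bound:
  fixes u :: "(real ^ 'n) \<times> real \<Rightarrow> ereal"
  assumes p: "p > 1"
    and u: "viscosity_supersolution p q \<Theta> u" and bnd: "\<And>\<xi>. \<xi> \<in> \<Theta> \<Longrightarrow> ereal k \<le> u \<xi>"
    and \<Theta>: "open \<Theta>" "bounded \<Theta>" and m: "m \<ge> 2" and e: "(2 * real m - 1) * (q - 1) > 1"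
    and bd: "\<And>\<xi>. \<xi> \<in> frontier \<Theta> \<Longrightarrow> ereal M \<le> Liminf (at \<xi> within \<Theta>) u"
    and \<epsilon>: "\<epsilon> > 0" and z: "z \<in> \<Theta>"
  shows "ereal (M - \<epsilon>) \<le> u z"
proof -
  obtain R where R: "R > 0" "closure \<Theta> \<subseteq> ball 0 R"
    using bounded_closure[OF \<Theta>(2)] bounded_subset_ballD by blast
  have snd: "\<bar>snd \<xi>\<bar> < R" if "\<xi> \<in> closure \<Theta>" for \<xi>
    using R that by (metis dist_0_norm mem_ball norm_snd_le order_le_less_trans real_norm_def subsetD prod.collapse)
  \<comment> \<open>On the closure of \<Theta>, t + R lies between 0 and 2R.\<close>
  define K where "K = \<epsilon> / (2 * R)"
  have K: "K > 0" using \<epsilon> R by (simp add: K_def)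
  have cl: "\<Theta> \<subseteq> closure \<Theta>" "frontier \<Theta> \<subseteq> closure \<Theta>"
    using closure_subset by (auto simp: frontier_def)
  have "ereal (M - 0 * rpow m 0 (fst z) - K * (snd z - (- R))) \<le> u z"
  proof (rule radial_comparison[OF p m e u bnd \<Theta>(1) compact_cball[of 0 R]])
    fix \<xi> assume \<xi>: "\<xi> \<in> frontier \<Theta>"
    have "0 < K * (snd \<xi> - (- R))" using snd[of \<xi>] \<xi> cl K by (intro mult_pos_pos) auto
    then have "ereal (M - 0 * rpow m 0 (fst \<xi>) - K * (snd \<xi> - (- R))) \<le> ereal M" by simp
    also have "\<dots> \<le> Liminf (at \<xi> within \<Theta>) u" by (rule bd[OF \<xi>])
    finally show "ereal (M - 0 * rpow m 0 (fst \<xi>) - K * (snd \<xi> - (- R))) \<le> Liminf (at \<xi> within \<Theta>) u" .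
  next
    show "z \<in> cball 0 R" using z cl R ball_subset_cball by blast
  next
    \<comment> \<open>Vacuous: \<Theta> lies in the open ball.\<close>
    fix \<xi> assume "\<xi> \<in> \<Theta>" "\<xi> \<notin> interior (cball (0 :: (real ^ 'n) \<times> real) R)"
    then show "ereal (M - 0 * rpow m 0 (fst \<xi>) - K * (snd \<xi> - (- R))) \<le> u \<xi>"
      using cl R by (auto simp: interior_cball)
  qed (use K z in auto)
  moreover have "K * (snd z - (- R)) \<le> \<epsilon>"
  proof -
    have "K * (snd z - (- R)) \<le> K * (2 * R)"
      using snd[of z] z cl K by (intro mult_left_mono) auto
    then show ?thesis using R by (simp add: K_def)
  qed
  then have "ereal (M - \<epsilon>) \<le> ereal (M - 0 * rpow m 0 (fst z) - K * (snd z - (- R)))" by simp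
  ultimately show ?thesis by (rule order_trans[rotated])
qed

subsection \<open>Truncated classical supersolutions\<close>

text \<open>Where the function equals M it is maximal, so a test function from below has a local
  maximum and all its first derivatives vanish. Elsewhere the point is interior to \<open>C\<close>
  and the function agrees with \<open>v\<close> nearby up to truncation, so ellipticity transfers
  the inequality from \<open>v\<close> to the test function.\<close>

lemma min_supersolution:
  fixes v :: "(real ^ 'n) \<times> real \<Rightarrow> real"
  assumes p: "p > 1" and \<Theta>: "open \<Theta>" and C: "closed C" and v: "continuous_on UNIV v"
    and bd: "\<And>z. z \<in> \<Theta> \<Longrightarrow> z \<in> C \<Longrightarrow> z \<notin> interior C \<Longrightarrow> M \<le> v z"
    and sup: "\<And>x t. (x, t) \<in> \<Theta> \<Longrightarrow> (x, t) \<in> interior C \<Longrightarrow> \<exists>G L T.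
       (\<forall>\<^sub>F y in nhds x. ((\<lambda>y. v (y, t)) has_derivative (\<lambda>h. G y \<bullet> h)) (at y)) \<and>
       (G has_derivative L) (at x) \<and> ((\<lambda>s. v (x, s)) has_real_derivative T) (at t) \<and> 0 \<le> T \<and>
       (G x \<noteq> 0 \<longrightarrow> pq_op p q (G x) (matrix L) \<le> T)"
  shows "viscosity_supersolution p q \<Theta> (\<lambda>z. ereal (if z \<in> C then min (v z) M else M))"
    (is "viscosity_supersolution p q \<Theta> ?u")
proof -
  have lsc: "?u \<xi> \<le> Liminf (at \<xi> within \<Theta>) ?u" if "\<xi> \<in> \<Theta>" for \<xi>
  proof (cases "\<xi> \<in> C")
    case True
    \<comment> \<open>The truncation of \<open>v\<close> on the whole space is a continuous minorant
      that agrees with the glued function at \<xi>.\<close>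
    have tend: "((\<lambda>z. ereal (min (v z) M)) \<longlongrightarrow> ereal (min (v \<xi>) M)) (at \<xi> within \<Theta>)"
    proof (intro tendsto_intros)
      show "(v \<longlongrightarrow> v \<xi>) (at \<xi> within \<Theta>)"
        using continuous_on_subset[OF v, of \<Theta>] that by (auto simp: continuous_on_def)
    qed
    show ?thesis
      unfolding le_Liminf_iff
    proof (intro allI impI)
      fix y assume "y < ?u \<xi>"
      then have "y < ereal (min (v \<xi>) M)" using True by simp
      from order_tendstoD(1)[OF tend this]
      show "\<forall>\<^sub>F z in at \<xi> within \<Theta>. y < ?u z"
        by eventually_elim (auto elim: less_le_trans)
    qed
  next
    case False
    then have "\<forall>\<^sub>F z in nhds \<xi>. z \<in> - C"
      using C by (intro eventually_nhds_in_open) auto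
    then have "\<forall>\<^sub>F z in at \<xi> within \<Theta>. ereal M \<le> ?u z"
      unfolding eventually_at_filter by eventually_elim auto
    then show ?thesis using False by (simp add: Liminf_bounded)
  qed
  have test: "(space_grad \<phi> \<xi> \<noteq> 0 \<longrightarrow> time_deriv \<phi> \<xi> - space_pq_laplacian p q \<phi> \<xi> \<ge> 0) \<and>
      (space_grad \<phi> \<xi> = 0 \<longrightarrow> time_deriv \<phi> \<xi> \<ge> 0)"
    if \<xi>: "\<xi> \<in> \<Theta>" and c2: "C2_on \<Theta> \<phi>" and touch: "touches_from_below \<Theta> \<phi> ?u \<xi>" for \<phi> \<xi>
  proof -
    obtain x t where xt: "\<xi> = (x, t)" by (cases \<xi>)
    obtain G L where G: "\<forall>\<^sub>F y in nhds x. ((\<lambda>y. \<phi> (y, t)) has_derivative (\<lambda>h. G y \<bullet> h)) (at y)"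
      and L: "(G has_derivative L) (at x)" and dt: "(\<lambda>s. \<phi> (x, s)) differentiable (at t)"
      using C2_on_slices[OF c2 \<Theta>, of x t] \<xi> xt by blast
    obtain T where T: "((\<lambda>s. \<phi> (x, s)) has_real_derivative T) (at t)"
      using dt by (auto simp: real_differentiable_def)
    have td: "time_deriv \<phi> \<xi> = T"
      using T by (simp add: time_deriv_def xt DERIV_imp_deriv)
    have sg: "space_grad \<phi> \<xi> = G x"
      by (simp add: space_grad_def xt grad_hess_eqI[OF G L])
    have slice_x: "filterlim (\<lambda>y. (y, t)) (nhds \<xi>) (nhds x)"
      unfolding xt by (intro tendsto_intros filterlim_ident)
    have slice_t: "filterlim (\<lambda>s. (x, s)) (nhds \<xi>) (nhds t)"
      unfolding xt by (intro tendsto_intros filterlim_ident)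
    have at\<xi>: "ereal (\<phi> \<xi>) = ?u \<xi>"
      using touch by (simp add: touches_from_below_def)
    have "\<forall>\<^sub>F \<eta> in nhds \<xi>. \<eta> \<in> \<Theta>" using \<Theta> \<xi> by (rule eventually_nhds_in_open)
    moreover have "\<forall>\<^sub>F \<eta> in nhds \<xi>. \<eta> \<noteq> \<xi> \<longrightarrow> \<eta> \<in> \<Theta> \<longrightarrow> ereal (\<phi> \<eta>) < ?u \<eta>"
      using touch unfolding touches_from_below_def eventually_at_filter by blast
    ultimately have below: "\<forall>\<^sub>F \<eta> in nhds \<xi>. ereal (\<phi> \<eta>) \<le> ?u \<eta>"
      by eventually_elim (use at\<xi> in \<open>metis less_imp_le order_refl\<close>)
    show ?thesis
    proof (cases "?u \<xi> = ereal M")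
      case True
      then have \<phi>\<xi>: "\<phi> \<xi> = M" using at\<xi> by simp
      have le: "\<forall>\<^sub>F \<eta> in nhds \<xi>. \<phi> \<eta> \<le> \<phi> \<xi>"
        using below by eventually_elim (auto simp: \<phi>\<xi> split: if_splits)
      have "(\<lambda>h. G x \<bullet> h) = (\<lambda>h. 0)"
      proof (rule has_derivative_local_max)
        show "((\<lambda>y. \<phi> (y, t)) has_derivative (\<lambda>h. G x \<bullet> h)) (at x)"
          using G by (rule eventually_nhds_x_imp_x)
        show "\<forall>\<^sub>F y in at x. \<phi> (x, t) \<ge> \<phi> (y, t)"
          using eventually_compose_filterlim[OF le slice_x]
          unfolding eventually_at_filter xt by eventually_elim simp
      qed
      then have "G x = 0" by (metis inner_eq_zero_iff)
      moreover have "T = 0"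
      proof -
        have "(*) T = (\<lambda>h. 0)"
        proof (rule has_derivative_local_max)
          show "((\<lambda>s. \<phi> (x, s)) has_derivative (*) T) (at t)"
            using T by (simp add: has_field_derivative_def)
          show "\<forall>\<^sub>F s in at t. \<phi> (x, t) \<ge> \<phi> (x, s)"
            using eventually_compose_filterlim[OF le slice_t]
            unfolding eventually_at_filter xt by eventually_elim simp
        qed
        then show ?thesis by (metis mult.right_neutral)
      qed
      ultimately show ?thesis by (simp add: sg td)
    next
      case False
      then have \<xi>C: "\<xi> \<in> C" and "v \<xi> < M" by (auto split: if_splits simp: min_def)
      then have \<xi>i: "\<xi> \<in> interior C" using bd[OF \<xi>] by fastforce
      have \<phi>\<xi>: "\<phi> \<xi> = v \<xi>" using at\<xi> \<xi>C \<open>v \<xi> < M\<close> by simp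
      have "\<forall>\<^sub>F \<eta> in nhds \<xi>. \<eta> \<in> interior C" using \<xi>i by (intro eventually_nhds_in_open) auto
      \<comment> \<open>In the interior of \<open>C\<close> the truncated function is at most
        \<open>v\<close>, so v - \<phi> has a local minimum at \<xi>.\<close>
      with below have le: "\<forall>\<^sub>F \<eta> in nhds \<xi>. v \<xi> - \<phi> \<xi> \<le> v \<eta> - \<phi> \<eta>"
        by eventually_elim (use interior_subset in \<open>auto simp: \<phi>\<xi> split: if_splits\<close>)
      obtain G' L' T' where G': "\<forall>\<^sub>F y in nhds x. ((\<lambda>y. v (y, t)) has_derivative (\<lambda>h. G' y \<bullet> h)) (at y)"
        and L': "(G' has_derivative L') (at x)" and T': "((\<lambda>s. v (x, s)) has_real_derivative T') (at t)"
        and T'0: "0 \<le> T'" and el: "G' x \<noteq> 0 \<longrightarrow> pq_op p q (G' x) (matrix L') \<le> T'"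
        using sup[of x t] \<xi> \<xi>i xt by blast
      have dG: "\<forall>\<^sub>F y in nhds x. ((\<lambda>y. v (y, t) - \<phi> (y, t)) has_derivative (\<lambda>h. (G' y - G y) \<bullet> h)) (at y)"
        using G G' by eventually_elim (simp add: inner_diff_left has_derivative_diff)
      have dL: "((\<lambda>y. G' y - G y) has_derivative (\<lambda>h. L' h - L h)) (at x)"
        by (intro has_derivative_diff L L')
      have min: "\<forall>\<^sub>F y in nhds x. v (x, t) - \<phi> (x, t) \<le> v (y, t) - \<phi> (y, t)"
        using eventually_compose_filterlim[OF le slice_x] by (simp add: xt)
      have GG: "G x = G' x" using second_derivative_test(1)[OF dG dL min] by simp
      have LL: "h \<bullet> L h \<le> h \<bullet> L' h" for h
        using second_derivative_test(2)[OF dG dL min, of h] by (simp add: inner_diff_right)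
      have "T = T'"
      proof -
        have "(*) (T' - T) = (\<lambda>h. 0)"
        proof (rule has_derivative_local_min)
          show "((\<lambda>s. v (x, s) - \<phi> (x, s)) has_derivative (*) (T' - T)) (at t)"
            using DERIV_diff[OF T' T] by (simp add: has_field_derivative_def)
          show "\<forall>\<^sub>F s in at t. v (x, t) - \<phi> (x, t) \<le> v (x, s) - \<phi> (x, s)"
            using eventually_compose_filterlim[OF le slice_t]
            unfolding eventually_at_filter xt by eventually_elim simp
        qed
        then have "T' - T = 0" by (metis mult.right_neutral)
        then show ?thesis by simp
      qed
      moreover have "space_pq_laplacian p q \<phi> \<xi> \<le> T'" if nz: "G x \<noteq> 0"
      proof -
        have "space_pq_laplacian p q \<phi> \<xi> = pq_op p q (G x) (matrix L)"
          using pq_laplacian_eqI[OF G L nz] by (simp add: space_pq_laplacian_def xt)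
        also have "\<dots> \<le> pq_op p q (G x) (matrix L')"
          by (rule pq_op_mono[OF has_derivative_linear[OF L] has_derivative_linear[OF L'] LL p nz])
        also have "\<dots> \<le> T'" using el nz GG by simp
        finally show ?thesis .
      qed
      ultimately show ?thesis using T'0 by (auto simp: sg td)
    qed
  qed
  have "\<Theta> \<subseteq> closure {\<xi> \<in> \<Theta>. ?u \<xi> \<noteq> \<infinity>}" by (simp add: closure_subset)
  then show ?thesis
    unfolding viscosity_supersolution_def using lsc test by auto
qed

subsection \<open>Regularity\<close>

lemma tendsto_erealI:
  assumes "\<And>\<epsilon>. \<epsilon> > 0 \<Longrightarrow> \<forall>\<^sub>F x in F. ereal (l - \<epsilon>) \<le> f x \<and> f x \<le> ereal (l + \<epsilon>)"
  shows "(f \<longlongrightarrow> ereal l) F"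
proof (rule order_tendstoI)
  fix a assume "a < ereal l"
  then obtain r where r: "a < ereal r" "ereal r < ereal l" using ereal_dense2 by blast
  show "\<forall>\<^sub>F x in F. a < f x"
    using assms[of "l - r"] r by (auto elim!: eventually_mono intro: less_le_trans)
next
  fix a assume "ereal l < a"
  then obtain r where r: "ereal l < ereal r" "ereal r < a" using ereal_dense2 by blast
  show "\<forall>\<^sub>F x in F. f x < a"
    using assms[of "r - l"] r by (auto elim!: eventually_mono intro: le_less_trans)
qed

text \<open>The point is not in the past part itself, hence not in its interior, so missing the
  frontier means missing the closure. The conclusion is for \<open>closure \<Theta>\<close> because
  the barrier must be nonnegative at frontier points too.\<close>

lemma closure_past_empty:
  fixes \<Theta> :: "('a::real_normed_vector \<times> real) set"
  assumes "open \<Theta>" and "(x\<^sub>0, t\<^sub>0) \<in> frontier \<Theta>" and "(x\<^sub>0, t\<^sub>0) \<notin> frontier {(x, t) \<in> \<Theta>. t < t\<^sub>0}"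
  obtains \<delta> where "\<delta> > 0" "\<And>x t. (x, t) \<in> closure \<Theta> \<Longrightarrow> (x, t) \<in> ball (x\<^sub>0, t\<^sub>0) \<delta> \<Longrightarrow> t\<^sub>0 \<le> t"
proof -
  let ?P = "{(x, t) \<in> \<Theta>. t < t\<^sub>0}"
  have "(x\<^sub>0, t\<^sub>0) \<notin> interior ?P"
    using interior_subset[of ?P] by auto
  with assms(3) have "(x\<^sub>0, t\<^sub>0) \<in> - closure ?P"
    by (simp add: frontier_def)
  then obtain \<delta> where \<delta>: "\<delta> > 0" "ball (x\<^sub>0, t\<^sub>0) \<delta> \<subseteq> - closure ?P"
    using open_contains_ball[of "- closure ?P"] by auto
  have "t\<^sub>0 \<le> t" if "(x, t) \<in> closure \<Theta>" "(x, t) \<in> ball (x\<^sub>0, t\<^sub>0) \<delta>" for x t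
  proof (rule ccontr)
    assume "\<not> t\<^sub>0 \<le> t"
    let ?U = "ball (x\<^sub>0, t\<^sub>0) \<delta> \<inter> snd -` {..<t\<^sub>0}"
    have "open ?U"
      by (intro open_Int open_ball open_vimage_snd open_lessThan)
    moreover have "(x, t) \<in> ?U \<inter> closure \<Theta>" using that \<open>\<not> t\<^sub>0 \<le> t\<close> by simp
    ultimately have "?U \<inter> \<Theta> \<noteq> {}" using open_Int_closure_eq_empty by blast
    then obtain z where z: "z \<in> ball (x\<^sub>0, t\<^sub>0) \<delta>" "snd z < t\<^sub>0" "z \<in> \<Theta>" by blast
    then have "z \<in> ?P" by (cases z) simp
    with z(1) \<delta>(2) closure_subset[of ?P] show False by blast
  qed
  with \<delta>(1) show thesis by (rule that)
qed

lemma regular_point_of_no_past: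
  fixes \<Theta> :: "((real ^ 'n) \<times> real) set"
  assumes p: "p > 1" and q: "q > 1" and \<Theta>: "open \<Theta>" "bounded \<Theta>"
    and \<xi>0: "(x\<^sub>0, t\<^sub>0) \<in> frontier \<Theta>"
    and past: "(x\<^sub>0, t\<^sub>0) \<notin> frontier {(x, t) \<in> \<Theta>. t < t\<^sub>0}"
  shows "regular_point p q \<Theta> (x\<^sub>0, t\<^sub>0)"
  unfolding regular_point_def
proof (intro conjI allI impI \<xi>0 tendsto_erealI)
  fix f :: "(real ^ 'n) \<times> real \<Rightarrow> real" and \<epsilon>' :: real
  assume f: "continuous_on (frontier \<Theta>) f" and \<epsilon>': "\<epsilon>' > 0"
  \<comment> \<open>One half for the oscillation of \<open>f\<close> near the point, one half for
    \<open>g\<close> near the point.\<close>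
  define \<epsilon> where "\<epsilon> = \<epsilon>' / 2"
  have \<epsilon>: "\<epsilon> > 0" using \<epsilon>' by (simp add: \<epsilon>_def)
  let ?f0 = "f (x\<^sub>0, t\<^sub>0)"
  have "compact (f ` frontier \<Theta>)"
    using f \<Theta>(2) by (intro compact_continuous_image) (auto simp: compact_frontier_bounded)
  then obtain M where M: "\<And>\<xi>. \<xi> \<in> frontier \<Theta> \<Longrightarrow> \<bar>f \<xi>\<bar> \<le> M"
    using compact_imp_bounded by (metis bounded_iff image_eqI real_norm_def)
  have M0: "\<bar>?f0\<bar> \<le> M" "0 \<le> M" using M[OF \<xi>0] by auto

  obtain k :: nat where k: "k > 1 / (q - 1)" using reals_Archimedean2 by blast
  \<comment> \<open>The shift by 2 yields m \<ge> 2, and 2m - 1 \<ge> k yields the exponent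
    condition.\<close>
  define m where "m = k + 2"
  have m: "m \<ge> 2" by (simp add: m_def)
  have e: "(2 * real m - 1) * (q - 1) > 1"
  proof -
    have "1 < k * (q - 1)" using k q by (simp add: field_simps)
    also have "\<dots> \<le> (2 * real m - 1) * (q - 1)" using q by (intro mult_right_mono) (auto simp: m_def)
    finally show ?thesis .
  qed

  obtain \<delta>1 where \<delta>1: "\<delta>1 > 0"
    and future: "\<And>x t. (x, t) \<in> closure \<Theta> \<Longrightarrow> (x, t) \<in> ball (x\<^sub>0, t\<^sub>0) \<delta>1 \<Longrightarrow> t\<^sub>0 \<le> t"
    using closure_past_empty[OF \<Theta>(1) \<xi>0 past] by blast
  obtain \<delta>2 where \<delta>2: "\<delta>2 > 0"
    and near: "\<And>\<xi>. \<xi> \<in> frontier \<Theta> \<Longrightarrow> dist \<xi> (x\<^sub>0, t\<^sub>0) < \<delta>2 \<Longrightarrow> \<bar>f \<xi> - ?f0\<bar> < \<epsilon>"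
    using f \<xi>0 \<epsilon> unfolding continuous_on_iff dist_real_def by blast
  \<comment> \<open>Points of the cylinder have distance at most 2 \<rho> from its centre.\<close>
  define \<rho> where "\<rho> = min \<delta>1 \<delta>2 / 3"
  have \<rho>: "\<rho> > 0" using \<delta>1 \<delta>2 by (simp add: \<rho>_def)
  define C where "C = cball x\<^sub>0 \<rho> \<times> cball t\<^sub>0 \<rho>"
  have C: "compact C" by (simp add: C_def compact_Times)
  have intC: "interior C = ball x\<^sub>0 \<rho> \<times> ball t\<^sub>0 \<rho>"
    by (simp add: C_def interior_Times)
  have Cdist: "dist \<xi> (x\<^sub>0, t\<^sub>0) < min \<delta>1 \<delta>2" if "\<xi> \<in> C" for \<xi>
  proof -
    obtain x t where \<xi>: "\<xi> = (x, t)" by (cases \<xi>)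
    have "dist \<xi> (x\<^sub>0, t\<^sub>0) \<le> dist x x\<^sub>0 + dist t t\<^sub>0"
      unfolding \<xi> dist_Pair_Pair by (rule sqrt_sum_squares_le_sum) auto
    also have "\<dots> \<le> 2 * \<rho>" using that by (auto simp: C_def \<xi> dist_commute)
    also have "\<dots> < min \<delta>1 \<delta>2" using \<delta>1 \<delta>2 by (auto simp: \<rho>_def)
    finally show ?thesis .
  qed
  have Cfuture: "t\<^sub>0 \<le> snd \<xi>" if "\<xi> \<in> closure \<Theta>" "\<xi> \<in> C" for \<xi>
    using future[of "fst \<xi>" "snd \<xi>"] Cdist[OF that(2)] that(1) by (simp add: dist_commute)
  have cl: "\<Theta> \<subseteq> closure \<Theta>" "frontier \<Theta> \<subseteq> closure \<Theta>"
    using closure_subset by (auto simp: frontier_def)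

  \<comment> \<open>Chosen so that the spatial term is 2M + 1 on the lateral boundary; the 1 keeps
    it positive when M = 0.\<close>
  define A where "A = (2 * M + 1) / \<rho> ^ (2 * m)"
  have A: "A > 0" using M0 \<rho> by (simp add: A_def)
  let ?e = "(2 * real m - 1) * (q - 1) - 1"
  let ?R = "rconst TYPE('n) p q m A * \<rho> powr ?e"
  have R: "0 \<le> rconst TYPE('n) p q m A"
    using m by (intro rconst_nonneg p) simp
  then have R0: "0 \<le> ?R" by simp
  \<comment> \<open>\<open>?R\<close> dominates the operator on \<open>C\<close>; the other summand
    makes this strict and lifts \<open>g\<close> above 2M at the top t = t0 + \<rho>.\<close>
  define K where "K = ?R + (2 * M + 1) / \<rho>"
  have K: "K > 0" using R0 M0 \<rho> by (auto simp: K_def intro!: add_nonneg_pos)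
  have K': "rconst TYPE('n) p q m A * norm (x - x\<^sub>0) powr ?e < K" if "(x, t) \<in> C" for x t
  proof -
    have "norm (x - x\<^sub>0) \<le> \<rho>" using that by (simp add: C_def dist_norm norm_minus_commute)
    then have "rconst TYPE('n) p q m A * norm (x - x\<^sub>0) powr ?e \<le> ?R"
      using e R by (intro mult_left_mono powr_mono2) auto
    also have "\<dots> < K" using M0 \<rho> by (simp add: K_def)
    finally show ?thesis .
  qed
  define g where "g z = A * rpow m x\<^sub>0 (fst z) + K * (snd z - t\<^sub>0)" for z
  have g0: "0 \<le> g \<xi>" if "\<xi> \<in> closure \<Theta>" "\<xi> \<in> C" for \<xi>
    using Cfuture[OF that] A K by (simp add: g_def rpow_nonneg)
  have gbd: "2 * M \<le> g \<xi>" if "\<xi> \<in> \<Theta>" "\<xi> \<in> C" "\<xi> \<notin> interior C" for \<xi>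
  proof -
    have t: "t\<^sub>0 \<le> snd \<xi>" using Cfuture that cl by blast
    have "dist x\<^sub>0 (fst \<xi>) = \<rho> \<or> dist t\<^sub>0 (snd \<xi>) = \<rho>"
      using that(2) that(3)[unfolded intC] by (cases \<xi>) (auto simp: C_def)
    then show ?thesis
    proof
      assume "dist x\<^sub>0 (fst \<xi>) = \<rho>"
      then have "A * rpow m x\<^sub>0 (fst \<xi>) = 2 * M + 1"
        using \<rho> by (simp add: A_def rpow_norm dist_norm norm_minus_commute)
      moreover have "0 \<le> K * (snd \<xi> - t\<^sub>0)" using t K by simp
      ultimately show ?thesis by (simp add: g_def)
    next
      assume "dist t\<^sub>0 (snd \<xi>) = \<rho>"
      \<comment> \<open>The bottom of the cylinder does not occur, since \<Theta> has no past
        there.\<close>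
      then have "snd \<xi> - t\<^sub>0 = \<rho>" using t by (simp add: dist_real_def)
      then have "K * (snd \<xi> - t\<^sub>0) = ?R * \<rho> + (2 * M + 1)"
        using \<rho> by (simp add: K_def field_simps)
      moreover have "0 \<le> ?R * \<rho>" using R0 \<rho> by simp
      moreover have "0 \<le> A * rpow m x\<^sub>0 (fst \<xi>)" using A by (simp add: rpow_nonneg)
      ultimately show ?thesis by (simp add: g_def)
    qed
  qed
  have g_cont: "continuous_on UNIV g"
    unfolding g_def by (intro continuous_intros rpow_continuous_on)
  have g_near: "\<forall>\<^sub>F \<xi> in at (x\<^sub>0, t\<^sub>0) within \<Theta>. \<xi> \<in> \<Theta> \<and> \<xi> \<in> C \<and> g \<xi> < \<epsilon>"
  proof -
    have "(x\<^sub>0, t\<^sub>0) \<in> interior C" using \<rho> by (simp add: intC)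
    then have "\<forall>\<^sub>F \<xi> in nhds (x\<^sub>0, t\<^sub>0). \<xi> \<in> interior C"
      by (intro eventually_nhds_in_open) auto
    moreover have "\<forall>\<^sub>F \<xi> in nhds (x\<^sub>0, t\<^sub>0). g \<xi> < \<epsilon>"
    proof -
      have "open (g -` {..<\<epsilon>})" using g_cont by (intro open_vimage) auto
      moreover have "g (x\<^sub>0, t\<^sub>0) < \<epsilon>" using \<epsilon> m by (simp add: g_def rpow_same)
      ultimately show ?thesis by (auto simp: eventually_nhds)
    qed
    ultimately show ?thesis
      unfolding eventually_at_filter
      by eventually_elim (use interior_subset in blast)
  qed

  have lower: "ereal (?f0 - \<epsilon> - g \<xi>) \<le> u \<xi>"
    if u: "u \<in> upper_class p q \<Theta> f" and \<xi>: "\<xi> \<in> \<Theta>" "\<xi> \<in> C" for u \<xi>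
  proof -
    from u obtain b where vs: "viscosity_supersolution p q \<Theta> u"
      and b: "\<And>\<xi>. \<xi> \<in> \<Theta> \<Longrightarrow> ereal b \<le> u \<xi>"
      and bd: "\<And>\<xi>. \<xi> \<in> frontier \<Theta> \<Longrightarrow> ereal (f \<xi>) \<le> Liminf (at \<xi> within \<Theta>) u"
      by (auto simp: upper_class_def)
    have bd': "ereal (- M) \<le> Liminf (at \<xi> within \<Theta>) u" if "\<xi> \<in> frontier \<Theta>" for \<xi>
      using M[OF that] by (intro order_trans[OF _ bd[OF that]]) auto
    have "ereal (?f0 - \<epsilon> - A * rpow m x\<^sub>0 (fst \<xi>) - K * (snd \<xi> - t\<^sub>0)) \<le> u \<xi>"
    proof (rule radial_comparison[OF p m e vs b \<Theta>(1) C _ K _ _ _ \<xi>])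
      fix \<eta> assume \<eta>: "\<eta> \<in> frontier \<Theta>" "\<eta> \<in> C"
      have "\<bar>f \<eta> - ?f0\<bar> < \<epsilon>" using near[OF \<eta>(1)] Cdist[OF \<eta>(2)] by simp
      moreover have "0 \<le> g \<eta>" using g0 \<eta> cl by blast
      ultimately have "ereal (?f0 - \<epsilon> - A * rpow m x\<^sub>0 (fst \<eta>) - K * (snd \<eta> - t\<^sub>0)) \<le> ereal (f \<eta>)"
        by (simp add: g_def)
      also have "\<dots> \<le> Liminf (at \<eta> within \<Theta>) u" by (rule bd[OF \<eta>(1)])
      finally show "ereal (?f0 - \<epsilon> - A * rpow m x\<^sub>0 (fst \<eta>) - K * (snd \<eta> - t\<^sub>0))
        \<le> Liminf (at \<eta> within \<Theta>) u" .
    next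
      fix \<eta> assume \<eta>: "\<eta> \<in> \<Theta>" "\<eta> \<in> C" "\<eta> \<notin> interior C"
      \<comment> \<open>g \<ge> 2M brings the value at the point, at most M, down to -M; the
        \<epsilon> pays for the loss in the minimum principle.\<close>
      have "ereal (?f0 - \<epsilon> - A * rpow m x\<^sub>0 (fst \<eta>) - K * (snd \<eta> - t\<^sub>0)) \<le> ereal (- M - \<epsilon>)"
        using gbd[OF \<eta>] M0 by (simp add: g_def)
      also have "\<dots> \<le> u \<eta>"
        by (rule supersolution_lower_bound[OF p vs b \<Theta> m e bd' \<epsilon> \<eta>(1)])
      finally show "ereal (?f0 - \<epsilon> - A * rpow m x\<^sub>0 (fst \<eta>) - K * (snd \<eta> - t\<^sub>0)) \<le> u \<eta>" .
    qed (use A K' in auto)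
    then show ?thesis by (simp add: g_def algebra_simps)
  qed

  define v where "v z = ?f0 + \<epsilon> + g z" for z
  \<comment> \<open>Off \<open>C\<close> the constant exceeds all boundary values; on the boundary
    of \<open>C\<close> inside \<Theta>, \<open>v\<close> has already reached it, so the pieces fit
    together.\<close>
  define u where "u z = ereal (if z \<in> C then min (v z) (M + \<epsilon>) else M + \<epsilon>)" for z
  have v_cont: "continuous_on UNIV v"
    unfolding v_def by (intro continuous_intros g_cont)
  \<comment> \<open>This settles the boundary condition at frontier points in \<open>C\<close>,
    where \<open>f\<close> stays below this constant.\<close>
  have u_low: "ereal (?f0 + \<epsilon>) \<le> u z" if "z \<in> \<Theta>" for z
    using g0[of z] that cl M0 by (auto simp: u_def v_def)
  have "u \<in> upper_class p q \<Theta> f"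
    unfolding upper_class_def
  proof (intro CollectI conjI ballI)
    show "viscosity_supersolution p q \<Theta> u"
      unfolding u_def[abs_def]
    proof (rule min_supersolution[OF p \<Theta>(1) compact_imp_closed[OF C] v_cont])
      fix z assume "z \<in> \<Theta>" "z \<in> C" "z \<notin> interior C"
      from gbd[OF this] show "M + \<epsilon> \<le> v z" using M0 by (simp add: v_def)
    next
      fix x t assume xt: "(x, t) \<in> \<Theta>" "(x, t) \<in> interior C"
      have eq: "(\<lambda>y. v (y, t)) = (\<lambda>x. A * rpow m x\<^sub>0 x + 0 * rpow m x\<^sub>0 x + (?f0 + \<epsilon> + K * (t - t\<^sub>0)))"
        by (simp add: v_def g_def algebra_simps)
      have "\<forall>\<^sub>F y in nhds x. ((\<lambda>y. v (y, t)) has_derivative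
          (\<lambda>h. (A *\<^sub>R rgrad m x\<^sub>0 y + 0 *\<^sub>R rgrad m x\<^sub>0 y) \<bullet> h)) (at y)"
        unfolding eq by (intro always_eventually allI rpow_sum_has_derivative)
      moreover have "((\<lambda>s. v (x, s)) has_real_derivative K) (at t)"
        unfolding v_def g_def by (auto intro!: derivative_eq_intros)
      moreover have "pq_op p q (A *\<^sub>R rgrad m x\<^sub>0 x + 0 *\<^sub>R rgrad m x\<^sub>0 x)
          (matrix (\<lambda>h. A *\<^sub>R rhess m x\<^sub>0 x h + 0 *\<^sub>R rhess m x\<^sub>0 x h)) \<le> K"
        if "A *\<^sub>R rgrad m x\<^sub>0 x + 0 *\<^sub>R rgrad m x\<^sub>0 x \<noteq> 0"
      proof -
        have "x \<noteq> x\<^sub>0" using that by auto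
        moreover have "(x, t) \<in> C" using xt(2) interior_subset by blast
        ultimately show ?thesis using pq_op_rpow[OF m, of x x\<^sub>0 A p q] K'[of x t] A by simp
      qed
      ultimately show "\<exists>G L T.
         (\<forall>\<^sub>F y in nhds x. ((\<lambda>y. v (y, t)) has_derivative (\<lambda>h. G y \<bullet> h)) (at y)) \<and>
         (G has_derivative L) (at x) \<and> ((\<lambda>s. v (x, s)) has_real_derivative T) (at t) \<and> 0 \<le> T \<and>
         (G x \<noteq> 0 \<longrightarrow> pq_op p q (G x) (matrix L) \<le> T)"
        using rgrad_sum_has_derivative[of A m x\<^sub>0 0 x\<^sub>0 x] K
        by (intro exI[of _ "\<lambda>y. A *\<^sub>R rgrad m x\<^sub>0 y + 0 *\<^sub>R rgrad m x\<^sub>0 y"]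
            exI[of _ "\<lambda>h. A *\<^sub>R rhess m x\<^sub>0 x h + 0 *\<^sub>R rhess m x\<^sub>0 x h"] exI[of _ K] conjI impI)
          auto
    qed
    show "\<exists>b :: real. \<forall>\<xi>\<in>\<Theta>. ereal b \<le> u \<xi>" using u_low by blast
    fix \<xi> assume \<xi>: "\<xi> \<in> frontier \<Theta>"
    show "ereal (f \<xi>) \<le> Liminf (at \<xi> within \<Theta>) u"
    proof (cases "\<xi> \<in> C")
      case True
      have "\<bar>f \<xi> - ?f0\<bar> < \<epsilon>" using near[OF \<xi>] Cdist[OF True] by simp
      then have le: "ereal (f \<xi>) \<le> ereal (?f0 + \<epsilon>)" by simp
      have "\<forall>\<^sub>F z in at \<xi> within \<Theta>. ereal (f \<xi>) \<le> u z"
        unfolding eventually_at_filter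
        by (intro always_eventually allI impI order_trans[OF le u_low])
      then show ?thesis by (rule Liminf_bounded)
    next
      case False
      then have "\<forall>\<^sub>F z in nhds \<xi>. z \<in> - C"
        using compact_imp_closed[OF C] by (intro eventually_nhds_in_open) auto
      then have "\<forall>\<^sub>F z in at \<xi> within \<Theta>. ereal (f \<xi>) \<le> u z"
        unfolding eventually_at_filter by eventually_elim (use M[OF \<xi>] \<epsilon> in \<open>auto simp: u_def\<close>)
      then show ?thesis by (rule Liminf_bounded)
    qed
  qed
  then have upper: "upper_perron p q \<Theta> f \<xi> \<le> u \<xi>" for \<xi>
    unfolding upper_perron_def by (rule INF_lower)
  show "\<forall>\<^sub>F \<xi> in at (x\<^sub>0, t\<^sub>0) within \<Theta>.
      ereal (?f0 - \<epsilon>') \<le> upper_perron p q \<Theta> f \<xi> \<and> upper_perron p q \<Theta> f \<xi> \<le> ereal (?f0 + \<epsilon>')"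
    using g_near
  proof eventually_elim
    case (elim \<xi>)
    have "ereal (?f0 - \<epsilon>') \<le> ereal (?f0 - \<epsilon> - g \<xi>)" using elim by (simp add: \<epsilon>_def)
    also have "\<dots> \<le> upper_perron p q \<Theta> f \<xi>"
      unfolding upper_perron_def using lower elim by (intro INF_greatest) auto
    finally have "ereal (?f0 - \<epsilon>') \<le> upper_perron p q \<Theta> f \<xi>" .
    moreover have "u \<xi> \<le> ereal (?f0 + \<epsilon>')"
      using elim by (simp add: u_def v_def \<epsilon>_def min_le_iff_disj)
    ultimately show ?case using upper[of \<xi>] by (auto intro: order_trans)
  qed
qed

theorem lemma7p3:
  fixes \<Theta> :: "((real ^ 'n) \<times> real) set" and p q :: real
    and x\<^sub>0 :: "real ^ 'n" and t\<^sub>0 :: real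
  assumes "p > 1" and "q > 1"
    and "open \<Theta>" and "bounded \<Theta>"
    and "(x\<^sub>0, t\<^sub>0) \<in> frontier \<Theta>"
  shows "((x\<^sub>0, t\<^sub>0) \<notin> frontier {(x, t) \<in> \<Theta>. t < t\<^sub>0} \<longrightarrow> regular_point p q \<Theta> (x\<^sub>0, t\<^sub>0))
    \<and> ({(x, t) \<in> \<Theta>. t < t\<^sub>0} = {} \<longrightarrow> regular_point p q \<Theta> (x\<^sub>0, t\<^sub>0))"
proof (intro conjI impI)
  show "regular_point p q \<Theta> (x\<^sub>0, t\<^sub>0)" if "(x\<^sub>0, t\<^sub>0) \<notin> frontier {(x, t) \<in> \<Theta>. t < t\<^sub>0}"
    by (rule regular_point_of_no_past[OF assms that])
  show "regular_point p q \<Theta> (x\<^sub>0, t\<^sub>0)" if "{(x, t) \<in> \<Theta>. t < t\<^sub>0} = {}"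
    by (rule regular_point_of_no_past[OF assms]) (simp only: that frontier_empty empty_iff not_False_eq_True)
qed

end
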